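(* Let $N\in\mathbb{N}$, $\alpha=-N-1$, $\gamma,\delta\ge0$, $\beta>\gamma+N$, $1\le n\le N$ and $\lambda(x)=x(x+\gamma+\delta+1)$. The polynomial $x\mapsto R_n(\lambda(x);\alpha,\beta,\gamma,\delta)$, where $R_n$ is the Racah polynomial, has $n$ simple roots $x_1<\dots<x_n$ in $(0,N)$ and other $n$ simple roots in $(-N-\gamma-\delta-1,-\gamma-\delta-1)$, with mutual distances greater than $1$. These $2n$ roots form the $(n,n)$-equilibrium distribution, with exclusion radius $h=1$, in $(0,N)\cup(-N-\gamma-\delta-1,-\gamma-\delta-1)$ under the external field $\phi^R$ with force $$F_{\phi^R}(x)=-(\phi^R)'(x)=\frac12\log\frac{(x+\alpha+1)(x+\gamma+1)(x+\beta+\delta+1)(x+\gamma+\delta+1)(2x+\gamma+\delta)}{x(x-\beta+\gamma)(x+\delta)(x-\alpha+\gamma+\delta)(2x+\gamma+\delta+2)}.$$ Moreover, the roots of the Racah polynomials $R_n(\cdot;\alpha,\beta,\gamma,\delta)$ (equivalently, the points $x_1<\dots<x_n$) are increasing functions of $N=-\alpha-1\in\mathbb{N}$ and decreasing functions of $\beta$.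
   Context: Racah polynomials: $R_n(\lambda(x);\alpha,\beta,\gamma,\delta)=\sum_{k=0}^n\frac{(-n)_k(n+\alpha+\beta+1)_k(-x)_k(x+\gamma+\delta+1)_k}{k!\,(\alpha+1)_k(\beta+\delta+1)_k(\gamma+1)_k}$, a polynomial of degree $n$ in $\lambda(x)=x(x+\gamma+\delta+1)$, where $(u)_k=u(u+1)\cdots(u+k-1)$ is the Pochhammer symbol. $(n,n)$-equilibrium distribution with $h=1$ in $(a,b)\cup(c,d)$: the unit-charge potential is $V_x(y)=\frac{x-y}{2}\log\left(\frac{y-x+1}{y-x-1}\right)-\frac12\log\big((y-x+1)(y-x-1)\big)$ for $|y-x|>1$, the energy is $\mathcal{E}_\phi(x_1,\dots,x_{2n})=\sum_{j\neq k}V_{x_k}(x_j)+2\sum_{j=1}^{2n}\phi(x_j)$, and an $(n,n)$-equilibrium distribution minimizes $\mathcal{E}_\phi$ among all $x_1,\dots,x_n\in(a,b)$, $x_{n+1},\dots,x_{2n}\in(c,d)$ with $|x_j-x_k|>1$ for $j\neq k$. Monotonicity is understood with $n$ and the other parameters fixed, among parameter values in the stated range. *)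

theory Defs
  imports "HOL-Analysis.Analysis" "HOL-Computational_Algebra.Polynomial"
begin

definition racah_lambda :: "real \<Rightarrow> real \<Rightarrow> real poly" where
  "racah_lambda \<gamma> \<delta> = [:0, \<gamma> + \<delta> + 1, 1:]"

lemma poly_racah_lambda: "poly (racah_lambda \<gamma> \<delta>) x = x * (x + \<gamma> + \<delta> + 1)"
  by (simp add: racah_lambda_def algebra_simps)

text \<open>The Racah polynomial as a polynomial in the variable \<open>\<lambda>\<close>: since
  \<open>(j - x) (x + \<gamma> + \<delta> + 1 + j) = j (j + \<gamma> + \<delta> + 1) - \<lambda>(x)\<close>, the factor
  \<open>(-x)\<^sub>k (x + \<gamma> + \<delta> + 1)\<^sub>k\<close> of the hypergeometric sum is a polynomial in \<open>\<lambda>(x)\<close>.  The usual formula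
  is recovered in \<open>poly_racah_of_lambda\<close> below.\<close>

definition racah_poly :: "nat \<Rightarrow> real \<Rightarrow> real \<Rightarrow> real \<Rightarrow> real \<Rightarrow> real poly" where
  "racah_poly n \<alpha> \<beta> \<gamma> \<delta> =
    (\<Sum>k\<le>n. smult
       (pochhammer (- real n) k * pochhammer (real n + \<alpha> + \<beta> + 1) k /
        (fact k * pochhammer (\<alpha> + 1) k * pochhammer (\<beta> + \<delta> + 1) k * pochhammer (\<gamma> + 1) k))
       (\<Prod>j<k. [:real j * (real j + \<gamma> + \<delta> + 1), - 1:]))"

definition racah_of_lambda :: "nat \<Rightarrow> real \<Rightarrow> real \<Rightarrow> real \<Rightarrow> real \<Rightarrow> real poly" where
  "racah_of_lambda n \<alpha> \<beta> \<gamma> \<delta> = pcompose (racah_poly n \<alpha> \<beta> \<gamma> \<delta>) (racah_lambda \<gamma> \<delta>)"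

lemma poly_racah_of_lambda:
  "poly (racah_of_lambda n \<alpha> \<beta> \<gamma> \<delta>) x =
    (\<Sum>k\<le>n. pochhammer (- real n) k * pochhammer (real n + \<alpha> + \<beta> + 1) k *
       pochhammer (- x) k * pochhammer (x + \<gamma> + \<delta> + 1) k /
       (fact k * pochhammer (\<alpha> + 1) k * pochhammer (\<beta> + \<delta> + 1) k * pochhammer (\<gamma> + 1) k))"
proof -
  have "poly (\<Prod>j<k. [:real j * (real j + \<gamma> + \<delta> + 1), - 1:]) (x * (x + \<gamma> + \<delta> + 1)) =
      pochhammer (- x) k * pochhammer (x + \<gamma> + \<delta> + 1) k" for k
    by (induction k) (simp_all add: pochhammer_Suc algebra_simps)
  then show ?thesis
    by (simp add: racah_of_lambda_def racah_poly_def poly_pcompose poly_racah_lambda poly_sum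
        mult.assoc)
qed

text \<open>Increasing lists of the zeros of the Racah polynomial in the variable \<open>\<lambda>\<close>, and of the points
  \<open>x\<^sub>1 < \<dots> < x\<^sub>n\<close> of \<open>(0, N)\<close>, for \<open>\<alpha> = -N-1\<close>.\<close>

definition racah_zeros :: "nat \<Rightarrow> nat \<Rightarrow> real \<Rightarrow> real \<Rightarrow> real \<Rightarrow> real list" where
  "racah_zeros n N \<beta> \<gamma> \<delta> =
    sorted_list_of_set {z. poly (racah_poly n (- real N - 1) \<beta> \<gamma> \<delta>) z = 0}"

definition racah_points :: "nat \<Rightarrow> nat \<Rightarrow> real \<Rightarrow> real \<Rightarrow> real \<Rightarrow> real list" where
  "racah_points n N \<beta> \<gamma> \<delta> =
    sorted_list_of_set
      {x \<in> {0<..<real N}. poly (racah_of_lambda n (- real N - 1) \<beta> \<gamma> \<delta>) x = 0}"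

definition unit_potential :: "real \<Rightarrow> real \<Rightarrow> real" where
  "unit_potential x y =
    (x - y) / 2 * ln ((y - x + 1) / (y - x - 1)) - 1 / 2 * ln ((y - x + 1) * (y - x - 1))"

definition energy :: "nat \<Rightarrow> (real \<Rightarrow> real) \<Rightarrow> (nat \<Rightarrow> real) \<Rightarrow> real" where
  "energy m \<phi> x =
    (\<Sum>j\<in>{1..m}. \<Sum>k\<in>{1..m} - {j}. unit_potential (x k) (x j)) + 2 * (\<Sum>j\<in>{1..m}. \<phi> (x j))"

definition admissible :: "nat \<Rightarrow> real \<Rightarrow> real \<Rightarrow> real \<Rightarrow> real \<Rightarrow> (nat \<Rightarrow> real) \<Rightarrow> bool" where
  "admissible n a b c d x \<longleftrightarrow>
    (\<forall>j\<in>{1..n}. x j \<in> {a<..<b}) \<and> (\<forall>j\<in>{n+1..2*n}. x j \<in> {c<..<d}) \<and>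
    (\<forall>j\<in>{1..2*n}. \<forall>k\<in>{1..2*n}. j \<noteq> k \<longrightarrow> 1 < \<bar>x j - x k\<bar>)"

definition equilibrium ::
  "nat \<Rightarrow> real \<Rightarrow> real \<Rightarrow> real \<Rightarrow> real \<Rightarrow> (real \<Rightarrow> real) \<Rightarrow> (nat \<Rightarrow> real) \<Rightarrow> bool" where
  "equilibrium n a b c d \<phi> x \<longleftrightarrow>
    admissible n a b c d x \<and>
    (\<forall>y. admissible n a b c d y \<longrightarrow> energy (2 * n) \<phi> x \<le> energy (2 * n) \<phi> y)"

definition racah_force :: "real \<Rightarrow> real \<Rightarrow> real \<Rightarrow> real \<Rightarrow> real \<Rightarrow> real" where
  "racah_force \<alpha> \<beta> \<gamma> \<delta> x =
    1 / 2 * ln (((x + \<alpha> + 1) * (x + \<gamma> + 1) * (x + \<beta> + \<delta> + 1) * (x + \<gamma> + \<delta> + 1) * (2 * x + \<gamma> + \<delta>)) /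
                (x * (x - \<beta> + \<gamma>) * (x + \<delta>) * (x - \<alpha> + \<gamma> + \<delta>) * (2 * x + \<gamma> + \<delta> + 2)))"

text \<open>The force determines the external field up to an additive constant on each of the two intervals.
  These constants do not affect minimizers, as each interval carries exactly \<open>n\<close> points.\<close>

definition racah_field :: "nat \<Rightarrow> real \<Rightarrow> real \<Rightarrow> real \<Rightarrow> (real \<Rightarrow> real) \<Rightarrow> bool" where
  "racah_field N \<beta> \<gamma> \<delta> \<phi> \<longleftrightarrow>
    (\<forall>x \<in> {0<..<real N} \<union> {- real N - \<gamma> - \<delta> - 1<..<- \<gamma> - \<delta> - 1}.
      (\<phi> has_real_derivative - racah_force (- real N - 1) \<beta> \<gamma> \<delta> x) (at x))"

lemma ex_racah_field:
  assumes "0 \<le> \<gamma>" "0 \<le> \<delta>" "\<gamma> + real N < \<beta>"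
  shows "\<exists>\<phi>. racah_field N \<beta> \<gamma> \<delta> \<phi>"
proof (cases "N = 0")
  case True
  then show ?thesis by (simp add: racah_field_def)
next
  case False
  let ?f = "\<lambda>x. - racah_force (- real N - 1) \<beta> \<gamma> \<delta> x"
  have cont: "isCont ?f x"
    if "x \<in> {0<..<real N} \<union> {- real N - \<gamma> - \<delta> - 1<..<- \<gamma> - \<delta> - 1}" for x
    unfolding racah_force_def
    using that assms by (intro continuous_intros) auto
  obtain F G where
    F: "\<And>x. 0 < x \<Longrightarrow> x < real N \<Longrightarrow> (F has_vector_derivative ?f x) (at x)" and
    G: "\<And>x. - real N - \<gamma> - \<delta> - 1 < x \<Longrightarrow> x < - \<gamma> - \<delta> - 1 \<Longrightarrow>
          (G has_vector_derivative ?f x) (at x)"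
    using einterval_antiderivative[of "ereal 0" "ereal (real N)" ?f]
      einterval_antiderivative[of "ereal (- real N - \<gamma> - \<delta> - 1)" "ereal (- \<gamma> - \<delta> - 1)" ?f]
      False cont by force
  define \<phi> where "\<phi> x = (if 0 < x then F x else G x)" for x
  have "(\<phi> has_real_derivative ?f x) (at x)" if "0 < x" "x < real N" for x
    by (rule has_field_derivative_transform_within_open[of F _ _ "{0<..}"])
      (use that F in \<open>auto simp: \<phi>_def has_real_derivative_iff_has_vector_derivative\<close>)
  moreover have "(\<phi> has_real_derivative ?f x) (at x)"
    if "- real N - \<gamma> - \<delta> - 1 < x" "x < - \<gamma> - \<delta> - 1" for x
    by (rule has_field_derivative_transform_within_open[of G _ _ "{..<0}"])
      (use that G assms in \<open>auto simp: \<phi>_def has_real_derivative_iff_has_vector_derivative\<close>)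
  ultimately show ?thesis
    unfolding racah_field_def by (intro exI[of _ \<phi>]) auto
qed

end

(* Put s = gamma + delta + 1 and lambda(x) = x (x + s).  The Racah polynomials satisfy a second order
   difference equation b(x) (y(x+1) - y(x)) + d(x) (y(x-1) - y(x)) = - mu y(x), with birth and death
   rates b, d positive on (0, N).  This operator is symmetric on the lattice lambda(0), ..., lambda(N),
   so R_n is orthogonal there to all polynomials of lower degree.  Hence its zeros are simple, lie
   inside the lattice and no two of them share a cell.  At a root a the equation reads
   b(a) y(a+1) = - d(a) y(a-1); comparing signs, this forces the roots to be more than 1 apart.
   Read multiplicatively, the same identity says that the total force on each of the 2n roots vanishes.
   The pair potential is convex on either side of the excluded zone and the external force strictly
   decreasing, so a balanced configuration is the unique minimizer of its order type.  Finally, the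
   balance equations prod_{r /= a} (lambda(a+1) - lambda(r)) / (lambda(a-1) - lambda(r)) = G(a), in which
   G decreases with N and increases with beta, give monotonicity by a maximum principle. *)

theory Submission
  imports Defs
begin

section \<open>Polynomials orthogonal on a finite set\<close>

text \<open>Orthogonality alone puts at most one root in each lattice cell, so two roots in adjacent
  cells might still be closer than 1. The sign comparison excludes this when exactly one other root
  lies within distance 1 of the chosen one; taking the topmost offending root and using the cell
  bound in its own cell and in the one below secures that. The second interval is the first one
  reflected by x -> -s - x, which fixes lambda and reverses the force. So everything is computed on
  (0, N), each root acting together with its mirror image. A root also feels its own image, the
  source of the factors 2x + gamma + delta and 2x + gamma + delta + 2 in the force. The energy is
  not convex on the whole configuration space, which falls into order types. It is however invariant
  under relabelling inside each interval, so every competitor can be compared with the roots listed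
  in its own order. N is discrete, so the roots are not differentiated in it; two critical
  configurations are compared directly instead, for N and beta alike.\<close>

lemma poly_no_root_constant_sign:
  fixes p :: "real poly"
  assumes "\<And>x. a < x \<Longrightarrow> x < b \<Longrightarrow> poly p x \<noteq> 0"
  shows "(\<forall>x\<in>{a..b}. 0 \<le> poly p x) \<or> (\<forall>x\<in>{a..b}. poly p x \<le> 0)"
proof (rule ccontr)
  assume "\<not> ?thesis"
  then obtain x y where xy: "x \<in> {a..b}" "y \<in> {a..b}" "poly p x < 0" "0 < poly p y"
    by (auto simp: not_le)
  then have "x \<noteq> y" by auto
  then consider "x < y" | "y < x" by linarith
  then have "\<exists>t. a < t \<and> t < b \<and> poly p t = 0"
  proof cases
    case 1
    from poly_IVT_pos[OF 1 xy(3,4)] obtain t where "x < t" "t < y" "poly p t = 0" by blast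
    with xy(1,2) show ?thesis by (intro exI[of _ t]) auto
  next
    case 2
    from poly_IVT_neg[OF 2 xy(4,3)] obtain t where "y < t" "t < x" "poly p t = 0" by blast
    with xy(1,2) show ?thesis by (intro exI[of _ t]) auto
  qed
  with assms show False by blast
qed

lemma poly_prod_root_factors: "poly (\<Prod>z\<in>Z. [:- z, 1:]) x = (\<Prod>z\<in>Z. x - z)"
  for x :: "'a::comm_ring_1"
  by (simp add: poly_prod)

lemma degree_prod_root_factors: "degree (\<Prod>z\<in>Z. [:- z, 1:]) = card Z"
  for Z :: "'a::idom set"
  by (subst degree_prod_eq_sum_degree) auto

text \<open>The set built here consists of the roots of odd multiplicity inside the interval.
  Dividing out one root at a time toggles its membership in \<open>Z\<close>, so multiplicities
  never have to be counted.\<close>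

lemma poly_constant_sign_mult:
  fixes p :: "real poly"
  assumes "p \<noteq> 0"
  shows "\<exists>Z. finite Z \<and> Z \<subseteq> {a<..<b} \<and> (\<forall>z\<in>Z. poly p z = 0) \<and>
    ((\<forall>x\<in>{a..b}. 0 \<le> poly (p * (\<Prod>z\<in>Z. [:- z, 1:])) x) \<or>
     (\<forall>x\<in>{a..b}. poly (p * (\<Prod>z\<in>Z. [:- z, 1:])) x \<le> 0))"
  using assms
proof (induction "degree p" arbitrary: p)
  case 0
  then obtain c where "p = [:c:]" by (metis degree_eq_zeroE)
  then show ?case by (intro exI[of _ "{}"]) auto
next
  case (Suc d)
  show ?case
  proof (cases "\<exists>z. a < z \<and> z < b \<and> poly p z = 0")
    case False
    with poly_no_root_constant_sign[of a b p] show ?thesis by (intro exI[of _ "{}"]) auto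
  next
    case True
    then obtain z where z: "a < z" "z < b" "poly p z = 0" by blast
    then obtain q where q: "p = [:- z, 1:] * q" by (metis dvdE poly_eq_0_iff_dvd)
    with Suc.prems have "q \<noteq> 0" by auto
    then have "degree p = Suc (degree q)" unfolding q by (subst degree_mult_eq) auto
    with Suc have "d = degree q" by simp
    from Suc.hyps(1)[OF this \<open>q \<noteq> 0\<close>] obtain Z where Z: "finite Z" "Z \<subseteq> {a<..<b}"
      "\<forall>z\<in>Z. poly q z = 0" and
      sgn: "(\<forall>x\<in>{a..b}. 0 \<le> poly (q * (\<Prod>z\<in>Z. [:- z, 1:])) x) \<or>
        (\<forall>x\<in>{a..b}. poly (q * (\<Prod>z\<in>Z. [:- z, 1:])) x \<le> 0)" by blast
    show ?thesis
    proof (cases "z \<in> Z")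
      case True
      have "p * (\<Prod>z\<in>Z - {z}. [:- z, 1:]) = q * (\<Prod>z\<in>Z. [:- z, 1:])"
        unfolding q prod.remove[OF Z(1) True] by (simp only: ac_simps)
      with sgn Z z show ?thesis by (intro exI[of _ "Z - {z}"]) (auto simp: q)
    next
      case False
      have *: "poly (p * (\<Prod>z\<in>insert z Z. [:- z, 1:])) x =
          (x - z)\<^sup>2 * poly (q * (\<Prod>z\<in>Z. [:- z, 1:])) x" for x
        by (simp add: q prod.insert[OF Z(1) False] power2_eq_square poly_prod algebra_simps)
      have "(\<forall>x\<in>{a..b}. 0 \<le> poly (p * (\<Prod>z\<in>insert z Z. [:- z, 1:])) x) \<or>
        (\<forall>x\<in>{a..b}. poly (p * (\<Prod>z\<in>insert z Z. [:- z, 1:])) x \<le> 0)"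
        using sgn unfolding * by (auto simp: mult_le_0_iff)
      with Z z show ?thesis
        by (intro exI[of _ "insert z Z"] conjI) (auto simp: q)
    qed
  qed
qed

locale discrete_orthogonal_poly =
  fixes p :: "real poly" and n N :: nat and l w :: "nat \<Rightarrow> real"
  assumes degree_p: "degree p = n" and p_nz: "p \<noteq> 0" and n_le: "n \<le> N"
    and l_less: "i < j \<Longrightarrow> l i < l j" and w_pos: "i \<le> N \<Longrightarrow> 0 < w i"
    and orthogonal: "degree q < n \<Longrightarrow> (\<Sum>i\<le>N. w i * poly p (l i) * poly q (l i)) = 0"
begin

text \<open>The orthogonality sum would have only nonnegative terms, hence only zero ones. The
  condition on the roots of \<open>q\<close> turns this into vanishing of \<open>p\<close> at all N
  + 1 nodes, more than its degree allows.\<close>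

lemma no_definite_multiplier:
  assumes "degree q < n" and nonneg: "\<And>i. i \<le> N \<Longrightarrow> 0 \<le> poly (p * q) (l i)"
    and root: "\<And>x. poly q x = 0 \<Longrightarrow> poly p x = 0"
  shows False
proof -
  have "\<forall>i\<in>{..N}. w i * poly p (l i) * poly q (l i) = 0"
    using orthogonal[OF assms(1)] nonneg w_pos
    by (subst sum_nonneg_eq_0_iff[symmetric])
      (auto intro!: mult_nonneg_nonneg simp: mult.assoc less_imp_le)
  with w_pos root have "poly p (l i) = 0" if "i \<le> N" for i
    using that by (fastforce simp: less_le)
  then have "l ` {..N} \<subseteq> {x. poly p x = 0}" by auto
  then have "card (l ` {..N}) \<le> card {x. poly p x = 0}"
    by (intro card_mono poly_roots_finite p_nz)
  also have "\<dots> \<le> n"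
    using p_nz degree_p card_poly_roots_bound by blast
  finally have "card (l ` {..N}) \<le> n" .
  moreover have "inj l"
    by (metis l_less linorder_injI order_less_irrefl)
  then have "card (l ` {..N}) = Suc N" by (simp add: card_image inj_on_subset)
  ultimately show False using n_le by simp
qed

text \<open>If fewer than n interior roots sufficed to fix the sign, their product or its negative
  would be a forbidden multiplier. So n of them exist, and they exhaust the degree.\<close>

lemma roots_inside_card:
  "{z. poly p z = 0} \<subseteq> {l 0<..<l N} \<and> card {z. poly p z = 0} = n"
proof -
  obtain Z where Z: "finite Z" "Z \<subseteq> {l 0<..<l N}" "\<forall>z\<in>Z. poly p z = 0" and
    sgn: "(\<forall>x\<in>{l 0..l N}. 0 \<le> poly (p * (\<Prod>z\<in>Z. [:- z, 1:])) x) \<or>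
        (\<forall>x\<in>{l 0..l N}. poly (p * (\<Prod>z\<in>Z. [:- z, 1:])) x \<le> 0)"
    using poly_constant_sign_mult[OF p_nz, of "l 0" "l N"] by (elim exE conjE) rule
  let ?q = "\<Prod>z\<in>Z. [:- z, 1:]"
  have l_in: "l i \<in> {l 0..l N}" if "i \<le> N" for i
    using that l_less[of 0 i] l_less[of i N] by (cases "i = 0"; cases "i = N") auto
  have root: "poly p x = 0" if "poly ?q x = 0" for x
    using that Z by (auto simp: poly_prod)
  have "\<not> card Z < n"
  proof
    assume "card Z < n"
    then have d: "degree ?q < n" "degree (- ?q) < n"
      by (simp_all add: degree_prod_root_factors)
    from sgn show False
    proof
      assume "\<forall>x\<in>{l 0..l N}. 0 \<le> poly (p * ?q) x"
      with no_definite_multiplier[OF d(1) _ root] l_in show False by blast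
    next
      assume "\<forall>x\<in>{l 0..l N}. poly (p * ?q) x \<le> 0"
      with no_definite_multiplier[OF d(2)] root l_in show False by auto
    qed
  qed
  moreover have fin: "finite {z. poly p z = 0}" by (rule poly_roots_finite[OF p_nz])
  moreover have "card {z. poly p z = 0} \<le> n"
    using p_nz degree_p card_poly_roots_bound by blast
  moreover have sub: "Z \<subseteq> {z. poly p z = 0}" using Z by auto
  ultimately have "card {z. poly p z = 0} = n" "Z = {z. poly p z = 0}"
    using card_mono[OF fin sub] card_subset_eq[OF fin sub] by linarith+
  with Z(2) show ?thesis by simp
qed

text \<open>Dividing out both roots leaves \<open>r\<close> with \<open>p * r\<close> = (x - y)(x -
  z) r^2. No node lies strictly between y and z, so this is nonnegative at every node and
  \<open>r\<close> is a forbidden multiplier.\<close>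

lemma root_unique_between_nodes:
  assumes "poly p y = 0" "poly p z = 0" "{y, z} \<subseteq> {l i..l (Suc i)}"
  shows "y = z"
proof (rule ccontr)
  assume "y \<noteq> z"
  from assms(1) obtain q where q: "p = [:- y, 1:] * q" by (metis dvdE poly_eq_0_iff_dvd)
  with assms(2) \<open>y \<noteq> z\<close> have "poly q z = 0" by auto
  then obtain r where r: "q = [:- z, 1:] * r" by (metis dvdE poly_eq_0_iff_dvd)
  have "r \<noteq> 0" using p_nz by (auto simp: q r)
  then have "degree p = Suc (Suc (degree r))"
    unfolding q r by (simp add: degree_mult_eq del: mult_pCons_left)
  then have "degree r < n" using degree_p by simp
  moreover have "0 \<le> poly (p * r) (l j)" for j
  proof -
    have "j \<le> i \<or> Suc i \<le> j" by linarith
    then have "l j \<le> l i \<or> l (Suc i) \<le> l j"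
      using l_less[of j i] l_less[of "Suc i" j] by (cases "j = i"; cases "j = Suc i") auto
    then have "0 \<le> (l j - y) * (l j - z)"
      using assms(3) by (auto simp: zero_le_mult_iff)
    then have "0 \<le> ((l j - y) * (l j - z)) * (poly r (l j))\<^sup>2" by simp
    also have "\<dots> = poly (p * r) (l j)" by (simp add: q r power2_eq_square algebra_simps)
    finally show ?thesis .
  qed
  moreover have "poly p x = 0" if "poly r x = 0" for x using that by (simp add: q r)
  ultimately show False using no_definite_multiplier by blast
qed

end

lemma poly_eq_prod_of_card_roots:
  fixes p :: "'a::idom poly"
  assumes "p \<noteq> 0" "card {z. poly p z = 0} = degree p"
  shows "p = smult (lead_coeff p) (\<Prod>z\<in>{z. poly p z = 0}. [:- z, 1:])"
  using assms
proof (induction "degree p" arbitrary: p)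
  case 0
  then obtain c where c: "p = [:c:]" by (metis degree_eq_zeroE)
  with 0 have "{z. poly p z = 0} = {}" by auto
  then show ?case by (simp add: c)
next
  case (Suc d)
  then obtain z where z: "poly p z = 0" by (metis (mono_tags) card_eq_0_iff empty_Collect_eq nat.distinct(1))
  then obtain q where q: "p = [:- z, 1:] * q" by (metis dvdE poly_eq_0_iff_dvd)
  with Suc.prems have nz: "q \<noteq> 0" by auto
  have deg: "degree p = Suc (degree q)" unfolding q by (subst degree_mult_eq) (use nz in auto)
  have roots: "{x. poly p x = 0} = insert z {x. poly q x = 0}" by (auto simp: q)
  have fin: "finite {x. poly q x = 0}" by (rule poly_roots_finite[OF nz])
  have "card {x. poly q x = 0} \<le> degree q" using nz card_poly_roots_bound by blast
  \<comment> \<open>Otherwise \<open>p\<close> and \<open>q\<close> would have the same roots, at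
    most \<open>degree q\<close> many, one too few for \<open>p\<close>.\<close>
  then have notin: "z \<notin> {x. poly q x = 0}"
    using Suc.prems(2) unfolding roots deg by (auto simp: insert_absorb)
  then have card: "card {x. poly q x = 0} = degree q"
    using Suc.prems(2) unfolding roots deg by (simp add: fin)
  have "d = degree q" using Suc.hyps(2) deg by simp
  from Suc.hyps(1)[OF this nz card]
  have "q = smult (lead_coeff q) (\<Prod>z\<in>{z. poly q z = 0}. [:- z, 1:])" .
  then have "p = smult (lead_coeff q) ([:- z, 1:] * (\<Prod>z\<in>{z. poly q z = 0}. [:- z, 1:]))"
    unfolding q by (metis mult_smult_right)
  moreover have "lead_coeff p = lead_coeff q" unfolding q by (simp only: lead_coeff_mult) simp
  ultimately show ?case
    unfolding roots prod.insert[OF fin notin] by (simp only:)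
qed

section \<open>The difference equation and orthogonality\<close>

locale racah_params =
  fixes N :: nat and \<beta> \<gamma> \<delta> :: real
  assumes gamma_nonneg: "0 \<le> \<gamma>" and delta_nonneg: "0 \<le> \<delta>" and beta_gt: "\<gamma> + real N < \<beta>"
begin

abbreviation s :: real where "s \<equiv> \<gamma> + \<delta> + 1"

definition lam :: "real \<Rightarrow> real" where "lam x = x * (x + s)"

text \<open>The standard coefficients B and D of the Racah difference equation for \<alpha> + 1 =
  -N, with reversed sign: \<open>birth\<close> is -B and \<open>death\<close> is -D, which makes
  both positive inside (0, N).\<close>

definition birth :: "real \<Rightarrow> real" where
  "birth x = (real N - x) * (x + \<beta> + \<delta> + 1) * (x + \<gamma> + 1) * (x + s) / ((2 * x + s) * (2 * x + s + 1))"

text \<open>For \<open>\<gamma> = \<delta> = 0\<close> the value at \<open>x = 0\<close> is a division by zero; the result \<open>0\<close> is the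
  one required at the left end of the lattice.\<close>

definition death :: "real \<Rightarrow> real" where
  "death x = x * (x + real N + s) * (\<beta> - \<gamma> - x) * (x + \<delta>) / ((2 * x + s - 1) * (2 * x + s))"

definition eigenvalue :: "nat \<Rightarrow> real" where
  "eigenvalue n = real n * (real n + \<beta> - real N)"

definition coefficient :: "nat \<Rightarrow> nat \<Rightarrow> real" where
  "coefficient n k = pochhammer (- real n) k * pochhammer (real n + \<beta> - real N) k /
    (fact k * pochhammer (- real N) k * pochhammer (\<beta> + \<delta> + 1) k * pochhammer (\<gamma> + 1) k)"

definition R :: "nat \<Rightarrow> real poly" where
  "R n = racah_poly n (- real N - 1) \<beta> \<gamma> \<delta>"

definition P :: "nat \<Rightarrow> real poly" where
  "P n = racah_of_lambda n (- real N - 1) \<beta> \<gamma> \<delta>"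

definition basis :: "nat \<Rightarrow> real \<Rightarrow> real" where
  "basis k x = pochhammer (- x) k * pochhammer (x + s) k"

lemma poly_P: "poly (P n) x = poly (R n) (lam x)"
  by (simp add: P_def R_def racah_of_lambda_def poly_pcompose poly_racah_lambda lam_def algebra_simps)

lemma poly_P_sum: "poly (P n) x = (\<Sum>k\<le>n. coefficient n k * basis k x)"
  by (simp add: P_def poly_racah_of_lambda coefficient_def basis_def algebra_simps)

lemma basis_Suc: "basis (Suc k) x = basis k x * (lam (real k) - lam x)"
  by (simp add: basis_def pochhammer_Suc lam_def algebra_simps)

definition diff_op :: "(real \<Rightarrow> real) \<Rightarrow> real \<Rightarrow> real" where
  "diff_op f x = birth x * (f (x + 1) - f x) + death x * (f (x - 1) - f x)"

text \<open>The difference of the basis values carries the factor \<open>2 * x + s + 1\<close>,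
  which cancels one denominator of \<open>birth\<close>. The other one, \<open>2 * x + s\<close>,
  cancels only after the death part is added, and is therefore kept on the left.\<close>

lemma birth_basis:
  assumes "0 \<le> x"
  shows "birth x * (basis (Suc k) (x + 1) - basis (Suc k) x) * (2 * x + s) =
    - (real k + 1) * basis k x * ((real N - x) * (x + \<beta> + \<delta> + 1) * (x + \<gamma> + 1) * (x + s + real k))"
proof -
  define p q where "p = pochhammer (- x) k" and "q = pochhammer (x + s + 1) k"
  have 1: "basis (Suc k) (x + 1) = (- x - 1) * p * (q * (x + s + 1 + real k))"
    unfolding basis_def pochhammer_rec[of "- (x + 1)"] pochhammer_Suc[of "x + 1 + s"] p_def q_def
    by (simp add: algebra_simps)
  have 2: "basis (Suc k) x = p * (- x + real k) * ((x + s) * q)"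
    unfolding basis_def pochhammer_rec[of "x + s"] pochhammer_Suc[of "- x"] p_def q_def
    by (simp add: algebra_simps)
  have "pochhammer (x + s) k * (x + s + real k) = (x + s) * q"
    unfolding q_def pochhammer_Suc[symmetric] pochhammer_rec[symmetric] ..
  then have 3: "basis k x * (x + s + real k) = p * ((x + s) * q)"
    unfolding basis_def p_def by (simp only: mult.assoc)
  have 4: "basis (Suc k) (x + 1) - basis (Suc k) x = - (real k + 1) * (p * q) * (2 * x + s + 1)"
    unfolding 1 2 by (simp add: algebra_simps)
  have 5: "2 * x + s + 1 \<noteq> 0" "2 * x + s \<noteq> 0" using assms gamma_nonneg delta_nonneg by linarith+
  have h: "birth x * (2 * x + s) * (2 * x + s + 1) =
      (real N - x) * (x + \<beta> + \<delta> + 1) * (x + \<gamma> + 1) * (x + s)"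
    unfolding birth_def using 5 by simp
  have "birth x * (basis (Suc k) (x + 1) - basis (Suc k) x) * (2 * x + s) =
    - (real k + 1) * (p * q) * ((real N - x) * (x + \<beta> + \<delta> + 1) * (x + \<gamma> + 1) * (x + s))"
    unfolding 4 h[symmetric] by (simp only: ac_simps)
  also have "\<dots> = - (real k + 1) * ((real N - x) * (x + \<beta> + \<delta> + 1) * (x + \<gamma> + 1)) * (p * ((x + s) * q))"
    by (simp only: ac_simps)
  finally show ?thesis unfolding 3[symmetric] by (simp only: ac_simps)
qed

lemma death_basis:
  assumes "0 \<le> x"
  shows "death x * (basis (Suc k) (x - 1) - basis (Suc k) x) * (2 * x + s) =
    - (real k + 1) * basis k x * ((x + real N + s) * (\<beta> - \<gamma> - x) * (x + \<delta>) * (real k - x))"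
proof -
  define p q where "p = pochhammer (1 - x) k" and "q = pochhammer (x + s) k"
  have 1: "basis (Suc k) (x - 1) = p * (1 - x + real k) * ((x + s - 1) * q)"
    unfolding basis_def pochhammer_rec[of "x - 1 + s"] pochhammer_Suc[of "- (x - 1)"] p_def q_def
    by (simp add: algebra_simps)
  have 2: "basis (Suc k) x = (- x) * p * (q * (x + s + real k))"
    unfolding basis_def pochhammer_rec[of "- x"] pochhammer_Suc[of "x + s"] p_def q_def
    by (simp add: algebra_simps)
  have "pochhammer (- x) k * (- x + real k) = (- x) * pochhammer (- x + 1) k"
    unfolding pochhammer_Suc[symmetric] pochhammer_rec[symmetric] ..
  then have "pochhammer (- x) k * (real k - x) = - x * p"
    unfolding p_def by (simp add: algebra_simps)
  then have "pochhammer (- x) k * (real k - x) * q = - (x * (p * q))" by simp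
  then have 3: "basis k x * (real k - x) = - (x * (p * q))"
    unfolding basis_def q_def by (simp only: ac_simps)
  have 4: "basis (Suc k) (x - 1) - basis (Suc k) x = (real k + 1) * (p * q) * (2 * x + s - 1)"
    unfolding 1 2 by (simp add: algebra_simps)
  \<comment> \<open>The factor \<open>2 * x + s - 1\<close> vanishes only for x = \<gamma> =
    \<delta> = 0, and then both sides of \<open>h\<close> are 0.\<close>
  have 5: "x = 0 \<or> 2 * x + s - 1 \<noteq> 0" "2 * x + s \<noteq> 0"
    using assms gamma_nonneg delta_nonneg by linarith+
  have h: "death x * (2 * x + s) * (2 * x + s - 1) =
      x * (x + real N + s) * (\<beta> - \<gamma> - x) * (x + \<delta>)"
    unfolding death_def using 5 by auto
  have "death x * (basis (Suc k) (x - 1) - basis (Suc k) x) * (2 * x + s) =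
    (real k + 1) * (p * q) * (x * (x + real N + s) * (\<beta> - \<gamma> - x) * (x + \<delta>))"
    unfolding 4 h[symmetric] by (simp only: ac_simps)
  also have "\<dots> = - (real k + 1) * ((x + real N + s) * (\<beta> - \<gamma> - x) * (x + \<delta>)) * - (x * (p * q))"
    by (simp only: mult_minus_left mult_minus_right minus_minus ac_simps)
  finally show ?thesis unfolding 3[symmetric] by (simp only: ac_simps)
qed

definition lowering :: "nat \<Rightarrow> real" where
  "lowering k = real k * (real N - real k + 1) * (\<beta> + \<delta> + real k) * (\<gamma> + real k)"

text \<open>The operator is bidiagonal in the hypergeometric basis, which reduces its eigenvector
  equation to a two-term recurrence for the coefficients.\<close>

lemma diff_op_basis:
  assumes "0 \<le> x"
  shows "diff_op (basis (Suc k)) x =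
    - eigenvalue (Suc k) * basis (Suc k) x - lowering (Suc k) * basis k x"
proof -
  have nz: "2 * x + s \<noteq> 0" using assms gamma_nonneg delta_nonneg by linarith
  \<comment> \<open>The two one-sided parts add up to a multiple of \<open>2 * x + s\<close>. The
    quotient is written with \<open>lam (real k) - lam x\<close>, the factor leading from
    \<open>basis k\<close> to \<open>basis (Suc k)\<close>, so that both entries can be read
    off.\<close>
  have "(real N - x) * (x + \<beta> + \<delta> + 1) * (x + \<gamma> + 1) * (x + s + real k) +
      (x + real N + s) * (\<beta> - \<gamma> - x) * (x + \<delta>) * (real k - x) =
    ((real (Suc k) + \<beta> - real N) * (lam (real k) - lam x) +
      (real N - real (Suc k) + 1) * (\<beta> + \<delta> + real (Suc k)) * (\<gamma> + real (Suc k))) * (2 * x + s)"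
    (is "?A + ?B = ?C * _")
    unfolding lam_def of_nat_Suc by algebra
  then have *: "- (real k + 1) * basis k x * ?A + - (real k + 1) * basis k x * ?B =
      - (real k + 1) * basis k x * (?C * (2 * x + s))"
    by (metis distrib_left)
  have "diff_op (basis (Suc k)) x * (2 * x + s) =
      - (real k + 1) * basis k x * ?A + - (real k + 1) * basis k x * ?B"
    unfolding diff_op_def distrib_right[of _ _ "2 * x + s"] birth_basis[OF assms] death_basis[OF assms] by simp
  also have "\<dots> = (- (real k + 1) * basis k x * ?C) * (2 * x + s)"
    unfolding * by (simp only: mult.assoc)
  finally have "diff_op (basis (Suc k)) x = - (real k + 1) * basis k x * ?C"
    using nz by (metis mult_right_cancel)
  then show ?thesis
    by (simp add: eigenvalue_def lowering_def basis_Suc algebra_simps)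
qed

text \<open>The eigenvector recurrence. At k = n both sides vanish because
  \<open>pochhammer (- real n) (Suc n)\<close> is 0; for n = N the denominator vanishes as well, and
  the quotient is still 0. This is what terminates the sum at n.\<close>

lemma coefficient_Suc:
  assumes "n \<le> N" "k \<le> n"
  shows "coefficient n (Suc k) * lowering (Suc k) = coefficient n k * (eigenvalue n - eigenvalue k)"
proof (cases "k = n")
  case True
  then show ?thesis by (simp add: coefficient_def pochhammer_of_nat_eq_0_iff)
next
  case False
  have pos: "pochhammer (- real N) (Suc k) \<noteq> 0"
    using False assms by (simp add: pochhammer_of_nat_eq_0_iff del: pochhammer_Suc)
  have pos1: "pochhammer (\<beta> + \<delta> + 1) (Suc k) > 0" "pochhammer (\<gamma> + 1) (Suc k) > 0"
    using gamma_nonneg delta_nonneg beta_gt by (intro pochhammer_pos; linarith)+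
  have nz: "\<beta> + \<delta> + 1 + real k \<noteq> 0" "\<gamma> + 1 + real k \<noteq> 0" "real k - real N \<noteq> 0" "real k + 1 \<noteq> 0"
    using gamma_nonneg delta_nonneg beta_gt False assms by linarith+
  have "coefficient n (Suc k) = coefficient n k * ((real k - real n) * (real n + \<beta> - real N + real k) /
      ((real k + 1) * (real k - real N) * (\<beta> + \<delta> + 1 + real k) * (\<gamma> + 1 + real k)))"
    unfolding coefficient_def pochhammer_Suc by (simp add: field_simps)
  moreover have "lowering (Suc k) = - ((real k + 1) * (real k - real N) * (\<beta> + \<delta> + 1 + real k) * (\<gamma> + 1 + real k))"
    unfolding lowering_def by (simp add: algebra_simps)
  ultimately have "coefficient n (Suc k) * lowering (Suc k) =
      - (coefficient n k * ((real k - real n) * (real n + \<beta> - real N + real k)))"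
    using nz by simp
  then show ?thesis unfolding eigenvalue_def by (simp add: algebra_simps)
qed

lemma diff_op_sum: "diff_op (\<lambda>x. \<Sum>k\<in>A. c k * f k x) x = (\<Sum>k\<in>A. c k * diff_op (f k) x)"
  unfolding diff_op_def
  by (simp add: sum_subtractf[symmetric] sum_distrib_left sum.distrib[symmetric] algebra_simps)

lemma diff_equation:
  assumes "0 \<le> x" "n \<le> N"
  shows "diff_op (poly (P n)) x = - eigenvalue n * poly (P n) x"
proof -
  have "diff_op (poly (P n)) x = (\<Sum>k\<le>n. coefficient n k * diff_op (basis k) x)"
    unfolding diff_op_sum[symmetric] poly_P_sum ..
  also have "\<dots> = (\<Sum>k\<le>n. - (coefficient n k * eigenvalue k * basis k x)) +
      (\<Sum>k\<in>{1..n}. - (coefficient n k * lowering k * basis (k - 1) x))"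
  proof -
    have eq: "coefficient n k * diff_op (basis k) x = - (coefficient n k * eigenvalue k * basis k x) +
        (if k = 0 then 0 else - (coefficient n k * lowering k * basis (k - 1) x))" for k
    proof (cases k)
      case 0
      then show ?thesis by (simp add: diff_op_def basis_def eigenvalue_def)
    next
      case (Suc j)
      then show ?thesis using diff_op_basis[OF assms(1), of j] by (simp add: right_diff_distrib)
    qed
    have "(\<Sum>k\<le>n. if k = 0 then 0 else - (coefficient n k * lowering k * basis (k - 1) x)) =
        (\<Sum>k\<in>{1..n}. - (coefficient n k * lowering k * basis (k - 1) x))"
      by (rule sum.mono_neutral_cong_right) auto
    then show ?thesis unfolding eq sum.distrib by simp
  qed
  also have "(\<Sum>k\<in>{1..n}. - (coefficient n k * lowering k * basis (k - 1) x)) =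
      (\<Sum>k<n. - (coefficient n (Suc k) * lowering (Suc k) * basis k x))"
    by (rule sum.reindex_bij_witness[of _ Suc "\<lambda>k. k - 1"]) auto
  \<comment> \<open>The extra term k = n is zero, by the recurrence at k = n.\<close>
  also have "\<dots> = (\<Sum>k\<le>n. - (coefficient n (Suc k) * lowering (Suc k) * basis k x))"
    using coefficient_Suc[OF assms(2), of n] by (simp add: lessThan_Suc_atMost[symmetric])
  also have "\<dots> = (\<Sum>k\<le>n. - (coefficient n k * (eigenvalue n - eigenvalue k) * basis k x))"
    using coefficient_Suc[OF assms(2)] by (intro sum.cong) auto
  finally show ?thesis
    unfolding poly_P_sum sum_distrib_left sum.distrib[symmetric]
    by (simp add: algebra_simps)
qed

section \<open>Self-adjointness on the lattice and discrete orthogonality\<close>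

lemma birth_pos: "0 \<le> x \<Longrightarrow> x < real N \<Longrightarrow> 0 < birth x"
  unfolding birth_def using gamma_nonneg delta_nonneg beta_gt
  by (intro divide_pos_pos mult_pos_pos) linarith+

lemma death_pos: "0 < x \<Longrightarrow> x \<le> real N \<Longrightarrow> 0 < death x"
  unfolding death_def using gamma_nonneg delta_nonneg beta_gt
  by (intro divide_pos_pos mult_pos_pos) linarith+

lemma birth_N [simp]: "birth (real N) = 0" by (simp add: birth_def)

lemma death_0 [simp]: "death 0 = 0" by (simp add: death_def)

text \<open>The Racah weight up to normalization, defined by detailed balance of the birth and death
  rates rather than in closed form, so that the operator is symmetric by construction.\<close>

primrec weight :: "nat \<Rightarrow> real" where
  "weight 0 = 1"
| "weight (Suc i) = weight i * birth (real i) / death (real (Suc i))"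

lemma weight_pos: "i \<le> N \<Longrightarrow> 0 < weight i"
  by (induction i) (auto intro!: divide_pos_pos mult_pos_pos birth_pos death_pos)

lemma weight_balance: "i < N \<Longrightarrow> weight (Suc i) * death (real (Suc i)) = weight i * birth (real i)"
  using death_pos[of "real (Suc i)"] by simp

text \<open>Summation by parts. The values of \<open>f\<close> and \<open>g\<close> beyond the ends
  of the lattice drop out because \<open>birth\<close> vanishes at N and \<open>death\<close> at 0.
  The right-hand side is symmetric in \<open>f\<close> and \<open>g\<close>.\<close>

lemma dirichlet_form:
  "(\<Sum>i\<le>N. weight i * diff_op f (real i) * g (real i)) =
    - (\<Sum>i<N. weight i * birth (real i) *
        ((f (real (Suc i)) - f (real i)) * (g (real (Suc i)) - g (real i))))"
proof -
  have "(\<Sum>i\<le>N. weight i * diff_op f (real i) * g (real i)) =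
      (\<Sum>i\<le>N. weight i * birth (real i) * ((f (real i + 1) - f (real i)) * g (real i))) +
      (\<Sum>i\<le>N. weight i * death (real i) * ((f (real i - 1) - f (real i)) * g (real i)))"
    unfolding sum.distrib[symmetric] diff_op_def by (simp add: algebra_simps)
  also have "(\<Sum>i\<le>N. weight i * birth (real i) * ((f (real i + 1) - f (real i)) * g (real i))) =
      (\<Sum>i<N. weight i * birth (real i) * ((f (real (Suc i)) - f (real i)) * g (real i)))"
    by (simp add: lessThan_Suc_atMost[symmetric] add.commute)
  also have "(\<Sum>i\<le>N. weight i * death (real i) * ((f (real i - 1) - f (real i)) * g (real i))) =
      (\<Sum>i<N. weight (Suc i) * death (real (Suc i)) *
        ((f (real i) - f (real (Suc i))) * g (real (Suc i))))"
    unfolding sum.atMost_shift by simp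
  also have "\<dots> = (\<Sum>i<N. weight i * birth (real i) *
        ((f (real i) - f (real (Suc i))) * g (real (Suc i))))"
    by (intro sum.cong refl, subst weight_balance) auto
  finally show ?thesis
    unfolding sum.distrib[symmetric] sum_negf[symmetric]
    by (simp add: algebra_simps)
qed

lemma eigenvalue_less: "m < n \<Longrightarrow> eigenvalue m < eigenvalue n"
proof -
  assume "m < n"
  then have "0 < (real n - real m) * (real n + real m + \<beta> - real N)"
    using gamma_nonneg beta_gt by (intro mult_pos_pos) linarith+
  then show ?thesis by (simp add: eigenvalue_def algebra_simps)
qed

lemma R_orthogonal:
  assumes "m < n" "n \<le> N"
  shows "(\<Sum>i\<le>N. weight i * poly (R n) (lam (real i)) * poly (R m) (lam (real i))) = 0"
proof -
  have "(\<Sum>i\<le>N. weight i * diff_op (poly (P n)) (real i) * poly (P m) (real i)) =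
      (\<Sum>i\<le>N. weight i * diff_op (poly (P m)) (real i) * poly (P n) (real i))"
    unfolding dirichlet_form by (simp add: mult.commute)
  then have "- eigenvalue n * (\<Sum>i\<le>N. weight i * poly (P n) (real i) * poly (P m) (real i)) =
      - eigenvalue m * (\<Sum>i\<le>N. weight i * poly (P n) (real i) * poly (P m) (real i))"
    unfolding sum_distrib_left using assms by (simp add: diff_equation ac_simps)
  then show ?thesis using eigenvalue_less[OF assms(1)] by (simp add: poly_P)
qed

lemma R_sum:
  "R n = (\<Sum>k\<le>n. smult (coefficient n k) (\<Prod>j<k. [:lam (real j), - 1:]))"
  unfolding R_def racah_poly_def coefficient_def lam_def
  by (simp add: algebra_simps)

lemma coefficient_diag_nonzero:
  assumes "n \<le> N"
  shows "coefficient n n \<noteq> 0"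
proof -
  have "pochhammer (real n + \<beta> - real N) n > 0" if "n > 0"
    using that gamma_nonneg beta_gt by (intro pochhammer_pos) linarith
  then have "pochhammer (real n + \<beta> - real N) n \<noteq> 0" by (cases n) auto
  moreover have "pochhammer (\<beta> + \<delta> + 1) n > 0" "pochhammer (\<gamma> + 1) n > 0"
    using gamma_nonneg delta_nonneg beta_gt by (intro pochhammer_pos; linarith)+
  moreover have "pochhammer (- real n) n \<noteq> 0" "pochhammer (- real N) n \<noteq> 0"
    using assms by (auto simp: pochhammer_of_nat_eq_0_iff)
  ultimately show ?thesis by (simp add: coefficient_def)
qed

lemma degree_R:
  assumes "n \<le> N"
  shows "degree (R n) = n" "R n \<noteq> 0"
proof -
  have deg: "degree (\<Prod>j<k. [:lam (real j), - 1:]) = k" for k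
    by (subst degree_prod_eq_sum_degree) auto
  have eq: "R n = (\<Sum>k<n. smult (coefficient n k) (\<Prod>j<k. [:lam (real j), - 1:])) +
      smult (coefficient n n) (\<Prod>j<n. [:lam (real j), - 1:])" (is "_ = ?A + ?B")
    unfolding R_sum by (simp add: lessThan_Suc_atMost[symmetric])
  have B: "degree ?B = n" using coefficient_diag_nonzero[OF assms] deg by simp
  show d: "degree (R n) = n"
  proof (cases "n = 0")
    case True
    then show ?thesis by (simp add: R_sum)
  next
    case False
    have "degree ?A < n"
      by (rule degree_sum_less) (use False deg in \<open>auto intro: le_less_trans[OF degree_smult_le]\<close>)
    then have "degree (?A + ?B) = degree ?B" by (intro degree_add_eq_right) (simp only: B)
    then show ?thesis unfolding eq by (simp only: B)
  qed
  show "R n \<noteq> 0"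
  proof (cases "n = 0")
    case True
    then show ?thesis using coefficient_diag_nonzero[OF assms] by (simp add: R_sum)
  next
    case False
    with d show ?thesis by auto
  qed
qed

text \<open>The \<open>R m\<close> with m < n realize every degree below n, so subtracting a
  multiple of one of them lowers the degree of \<open>q\<close>.\<close>

lemma R_orthogonal_lower_degree:
  assumes "n \<le> N" "degree q < n"
  shows "(\<Sum>i\<le>N. weight i * poly (R n) (lam (real i)) * poly q (lam (real i))) = 0"
  using assms(2)
proof (induction "degree q" arbitrary: q rule: less_induct)
  case less
  define m where "m = degree q"
  have m: "m < n" "m \<le> N" using less.prems assms by (auto simp: m_def)
  define c where "c = lead_coeff q / lead_coeff (R m)"
  define r where "r = q - smult c (R m)"
  have q: "q = smult c (R m) + r" by (simp add: r_def)
  have "degree r \<le> m" unfolding r_def using degree_R[OF m(2)]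
    by (intro degree_diff_le degree_smult_le[THEN order_trans]) (auto simp: m_def)
  moreover have "coeff r m = 0"
    using degree_R[OF m(2)] leading_coeff_0_iff[of "R m"] by (simp add: r_def c_def m_def)
  ultimately have "r = 0 \<or> degree r < m" by (rule eq_zero_or_degree_less)
  then have "(\<Sum>i\<le>N. weight i * poly (R n) (lam (real i)) * poly r (lam (real i))) = 0"
    using less m by (auto simp: m_def)
  moreover have "(\<Sum>i\<le>N. weight i * poly (R n) (lam (real i)) * poly q (lam (real i))) =
      c * (\<Sum>i\<le>N. weight i * poly (R n) (lam (real i)) * poly (R m) (lam (real i))) +
      (\<Sum>i\<le>N. weight i * poly (R n) (lam (real i)) * poly r (lam (real i)))"
    unfolding sum_distrib_left sum.distrib[symmetric] q by (simp add: algebra_simps)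
  ultimately show ?case using R_orthogonal[OF m(1) assms(1)] by simp
qed

section \<open>Location and separation of the roots\<close>

lemma lam_diff: "lam x - lam y = (x - y) * (x + y + s)"
  by (simp add: lam_def algebra_simps)

lemma lam_less_iff: "0 \<le> x \<Longrightarrow> 0 \<le> y \<Longrightarrow> lam x < lam y \<longleftrightarrow> x < y"
  using lam_diff[of x y] gamma_nonneg delta_nonneg
  by (auto simp: mult_less_0_iff simp flip: diff_less_0_iff_less[of "lam x"])

lemma lam_inj: "inj_on lam {0..}"
proof (rule inj_onI)
  fix x y assume "x \<in> {0..}" "y \<in> {0..}" "lam x = lam y"
  then show "x = y" using lam_less_iff[of x y] lam_less_iff[of y x] by force
qed

lemma lam_reflect: "lam (- s - x) = lam x"
  by (simp add: lam_def algebra_simps)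

lemma R_discrete_orthogonal:
  "n \<le> N \<Longrightarrow> discrete_orthogonal_poly (R n) n N (\<lambda>i. lam (real i)) weight"
  by unfold_locales (simp_all add: degree_R lam_less_iff weight_pos R_orthogonal_lower_degree)

definition X :: "nat \<Rightarrow> real set" where
  "X n = {x \<in> {0<..<real N}. poly (P n) x = 0}"

lemma finite_X: "n \<le> N \<Longrightarrow> finite (X n)"
proof -
  assume n: "n \<le> N"
  have "lam ` X n \<subseteq> {z. poly (R n) z = 0}" by (auto simp: X_def poly_P)
  then have "finite (lam ` X n)" using poly_roots_finite[OF degree_R(2)[OF n]] by (rule finite_subset)
  then show ?thesis by (rule finite_imageD) (rule inj_on_subset[OF lam_inj], auto simp: X_def)
qed

text \<open>All zeros of \<open>R n\<close> lie strictly between the end nodes \<open>lam 0\<close>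
  and \<open>lam N\<close>, so the intermediate value theorem pulls each of them back to (0,
  N).\<close>

lemma lam_image_X:
  assumes "n \<le> N"
  shows "lam ` X n = {z. poly (R n) z = 0}"
proof
  show "lam ` X n \<subseteq> {z. poly (R n) z = 0}" by (auto simp: X_def poly_P)
  show "{z. poly (R n) z = 0} \<subseteq> lam ` X n"
  proof
    fix z assume z: "z \<in> {z. poly (R n) z = 0}"
    then have "lam 0 < z" "z < lam (real N)"
      using discrete_orthogonal_poly.roots_inside_card[OF R_discrete_orthogonal[OF assms]] by auto
    moreover have "continuous_on {0..real N} lam"
      unfolding lam_def by (intro continuous_intros)
    ultimately obtain x where x: "0 \<le> x" "x \<le> real N" "lam x = z"
      using IVT'[of lam 0 z "real N"] by auto
    moreover have "x \<noteq> 0" "x \<noteq> real N" using x \<open>lam 0 < z\<close> \<open>z < lam (real N)\<close> by auto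
    ultimately show "z \<in> lam ` X n" using z by (auto simp: X_def poly_P intro!: image_eqI[of _ _ x])
  qed
qed

lemma lam_inj_X: "inj_on lam (X n)"
  by (rule inj_on_subset[OF lam_inj]) (auto simp: X_def)

lemma card_X: "n \<le> N \<Longrightarrow> card (X n) = n"
  using discrete_orthogonal_poly.roots_inside_card[OF R_discrete_orthogonal, of n]
    card_image[OF lam_inj_X, of n] lam_image_X[of n] by simp

lemma poly_P_factored:
  assumes "n \<le> N"
  shows "poly (P n) x = lead_coeff (R n) * (\<Prod>r\<in>X n. (x - r) * (x + r + s))"
proof -
  have "card {z. poly (R n) z = 0} = degree (R n)"
    using discrete_orthogonal_poly.roots_inside_card[OF R_discrete_orthogonal[OF assms]]
      degree_R[OF assms] by simp
  from poly_eq_prod_of_card_roots[OF degree_R(2)[OF assms] this]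
  have "poly (R n) (lam x) = lead_coeff (R n) * (\<Prod>z\<in>lam ` X n. lam x - z)"
    unfolding lam_image_X[OF assms] by (metis poly_prod_root_factors poly_smult)
  then show ?thesis
    unfolding poly_P prod.reindex[OF lam_inj_X] by (simp add: lam_diff)
qed

lemma lead_coeff_R: "n \<le> N \<Longrightarrow> lead_coeff (R n) \<noteq> 0"
  using degree_R(2) by (metis leading_coeff_0_iff)

lemma root_equation:
  assumes "n \<le> N" "a \<in> X n"
  shows "birth a * poly (P n) (a + 1) + death a * poly (P n) (a - 1) = 0"
  using diff_equation[of a n] assms by (simp add: X_def diff_op_def)

text \<open>Roots come in pairs r and -s - r with r > 0, and the second kind lies below -s. Since s
  is at least 1, this applies to a - 1 for every positive a, even when a - 1 is negative.\<close>

lemma root_in_X: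
  assumes "n \<le> N" "poly (P n) x = 0" "- s < x"
  shows "x \<in> X n"
proof -
  have "(\<Prod>r\<in>X n. (x - r) * (x + r + s)) = 0"
    using assms(2) lead_coeff_R[OF assms(1)] unfolding poly_P_factored[OF assms(1)]
    by (simp only: mult_eq_0_iff simp_thms)
  then obtain r where "r \<in> X n" "(x - r) * (x + r + s) = 0"
    unfolding prod_zero_iff[OF finite_X[OF assms(1)]] by blast
  moreover from \<open>r \<in> X n\<close> have "0 < r" by (simp add: X_def)
  then have "x + r + s \<noteq> 0" using assms(3) by linarith
  ultimately show ?thesis by simp
qed

text \<open>Two roots at distance 1 propagate to a descending chain of roots that leaves \<open>(0, N)\<close>.\<close>

lemma root_not_unit_distance:
  assumes "n \<le> N" "a \<in> X n"
  shows "a - 1 \<notin> X n"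
proof
  assume "a - 1 \<in> X n"
  have "a - real k \<in> X n" for k
  proof (induction k rule: induct_nat_012)
    case (ge2 k)
    have "poly (P n) (a - real (Suc k) + 1) = 0" using ge2(1) by (simp add: X_def)
    moreover have "death (a - real (Suc k)) > 0"
      using ge2(2) by (intro death_pos) (auto simp: X_def)
    ultimately have "poly (P n) (a - real (Suc k) - 1) = 0"
      using root_equation[OF assms(1) ge2(2)] by simp
    moreover have "a - real (Suc k) - 1 = a - real (Suc (Suc k))" by simp
    moreover have "- s < a - real (Suc k) - 1"
      using ge2(2) gamma_nonneg delta_nonneg by (simp add: X_def)
    ultimately show ?case using root_in_X[OF assms(1)] by metis
  qed (use assms \<open>a - 1 \<in> X n\<close> in auto)
  then have "0 < a - real (nat \<lceil>a\<rceil>)" by (auto simp: X_def)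
  then show False by linarith
qed

lemma root_unique_in_cell:
  assumes "n \<le> N" "y \<in> X n" "z \<in> X n" "{y, z} \<subseteq> {real i..real (Suc i)}"
  shows "y = z"
proof -
  have in_cell: "lam x \<in> {lam (real i)..lam (real (Suc i))}" if "x \<in> {real i..real (Suc i)}" for x
    using that by (auto simp del: of_nat_Suc simp: not_less[symmetric] lam_less_iff)
  have "poly (R n) (lam y) = 0" "poly (R n) (lam z) = 0"
    using assms(2,3) by (simp_all add: X_def poly_P)
  moreover have "{lam y, lam z} \<subseteq> {lam (real i)..lam (real (Suc i))}"
    using in_cell[of y] in_cell[of z] assms(4) by blast
  ultimately have "lam y = lam z"
    by (rule discrete_orthogonal_poly.root_unique_between_nodes[OF R_discrete_orthogonal[OF assms(1)]])
  then show ?thesis using assms(2,3) by (rule inj_onD[OF lam_inj_X])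
qed

text \<open>Otherwise let \<open>m\<close> be the largest root with another root within distance 1 below it.  Then there is
  exactly one such root \<open>q\<close>, which makes \<open>y(m+1) y(m-1)\<close> positive, against the difference equation.\<close>

lemma root_gap:
  assumes n: "n \<le> N" and ar: "a \<in> X n" "r \<in> X n" "r < a"
  shows "1 < a - r"
proof (rule ccontr)
  assume "\<not> 1 < a - r"
  with root_not_unit_distance[OF n ar(1)] ar have close: "a - 1 < r" by (cases "r = a - 1") auto
  define C where "C = {a \<in> X n. \<exists>r\<in>X n. a - 1 < r \<and> r < a}"
  have fin: "finite C" "C \<noteq> {}" using finite_X[OF n] ar close by (auto simp: C_def)
  define m where "m = Max C"
  have "m \<in> C" using fin by (simp add: m_def)
  then obtain q where mq: "m \<in> X n" "q \<in> X n" "m - 1 < q" "q < m" by (auto simp: C_def)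
  have m_max: "c \<le> m" if "c \<in> C" for c using that fin by (simp add: m_def)
  have m0: "0 < m" "m < real N" "0 < q" using mq by (auto simp: X_def)
  have unique: "\<bar>m - t\<bar> > 1" if t: "t \<in> X n - {m, q}" for t
  proof (rule ccontr)
    assume not: "\<not> \<bar>m - t\<bar> > 1"
    have "t \<noteq> m - 1" using root_not_unit_distance[OF n mq(1)] t by auto
    moreover have "m \<noteq> t - 1" using root_not_unit_distance[OF n, of t] mq(1) t by auto
    ultimately have near: "m - 1 < t" "t < m + 1" using not by linarith+
    moreover have "\<not> m < t" using m_max[of t] t mq(1) near by (force simp: C_def)
    ultimately have t': "m - 1 < t" "t < m" using t by auto
    have t0: "0 < t" using t by (auto simp: X_def)
    \<comment> \<open>The cell of \<open>m\<close>. Neither \<open>t\<close> nor \<open>q\<close>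
      can share it, so both fall into the cell just below, which has room for only one root.\<close>
    define i where "i = nat \<lfloor>m\<rfloor>"
    have "real i = real_of_int \<lfloor>m\<rfloor>" using m0 by (simp add: i_def)
    then have i: "real i \<le> m" "m < real (Suc i)" using m0 by (simp_all, linarith)
    have "t < real i" using root_unique_in_cell[OF n, of t m i] t mq i t' by force
    moreover have "q < real i" using root_unique_in_cell[OF n, of q m i] mq i by force
    moreover from \<open>t < real i\<close> t0 obtain k where "i = Suc k" by (cases i) auto
    ultimately have "{t, q} \<subseteq> {real k..real (Suc k)}" using t' mq i by auto
    then show False using root_unique_in_cell[OF n, of t q k] t mq by auto
  qed
  have pos: "0 < birth m" "0 < death m" using m0 by (auto intro: birth_pos death_pos)
  have nz: "poly (P n) (m - 1) \<noteq> 0"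
    using root_not_unit_distance[OF n mq(1)] root_in_X[OF n, of "m - 1"] m0 gamma_nonneg delta_nonneg
    by auto
  have "birth m * poly (P n) (m + 1) = - (death m * poly (P n) (m - 1))"
    using root_equation[OF n mq(1)] by linarith
  then have "birth m * (poly (P n) (m + 1) * poly (P n) (m - 1)) =
      - (death m * (poly (P n) (m - 1))\<^sup>2)"
    by (simp only: mult.assoc[symmetric] power2_eq_square) simp
  also have "\<dots> < 0" using pos nz by simp
  finally have "poly (P n) (m + 1) * poly (P n) (m - 1) < 0" using pos by (simp add: mult_less_0_iff)
  moreover have "poly (P n) (m + 1) * poly (P n) (m - 1) =
      (lead_coeff (R n))\<^sup>2 * (\<Prod>r\<in>X n. ((m - r)\<^sup>2 - 1) * ((m + 1 + r + s) * (m - 1 + r + s)))"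
  proof -
    have "(m - r) * (m - r) - 1 = (m + 1 - r) * (m - 1 - r)" for r :: real
      by (simp add: algebra_simps)
    then show ?thesis
      unfolding poly_P_factored[OF n] power2_eq_square prod.distrib by (simp only: prod.distrib ac_simps)
  qed
  \<comment> \<open>Exactly two factors are negative: that of \<open>m\<close> itself, where the
    square is 0, and that of \<open>q\<close>.\<close>
  moreover have "(\<Prod>r\<in>X n. ((m - r)\<^sup>2 - 1) * ((m + 1 + r + s) * (m - 1 + r + s))) > 0"
  proof -
    let ?f = "\<lambda>r. ((m - r)\<^sup>2 - 1) * ((m + 1 + r + s) * (m - 1 + r + s))"
    have fac: "0 < (m + 1 + r + s) * (m - 1 + r + s)" if "r \<in> X n" for r
      using that m0 gamma_nonneg delta_nonneg by (intro mult_pos_pos) (auto simp: X_def)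
    have "X n = insert m (insert q (X n - {m, q}))" using mq by auto
    then have "prod ?f (X n) = ?f m * (?f q * prod ?f (X n - {m, q}))"
      by (subst \<open>X n = _\<close>, subst prod.insert, use mq finite_X[OF n] in auto)
    moreover have "?f m < 0" using fac[OF mq(1)] by simp
    moreover have "?f q < 0"
      using fac[OF mq(2)] mq(3,4) by (intro mult_neg_pos) (auto simp: abs_square_less_1)
    moreover have "0 < prod ?f (X n - {m, q})"
    proof (rule prod_pos)
      fix t assume t: "t \<in> X n - {m, q}"
      have "1 < (m - t)\<^sup>2" using unique[OF t] by (metis abs_ge_zero abs_square_le_1 leD not_le)
      then show "0 < ?f t" using fac[of t] t by simp
    qed
    ultimately show ?thesis by (simp add: zero_less_mult_iff mult_less_0_iff)
  qed
  ultimately show False using lead_coeff_R[OF n] by (simp add: mult_less_0_iff not_less)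
qed

end

section \<open>Energy\<close>

lemma strict_tangent_below:
  fixes f f' :: "real \<Rightarrow> real"
  assumes deriv: "\<And>t. t \<in> S \<Longrightarrow> (f has_real_derivative f' t) (at t)"
    and mono: "strict_mono_on S f'" and S: "{min u v..max u v} \<subseteq> S" and "u \<noteq> v"
  shows "f u + f' u * (v - u) < f v"
proof -
  have in_S: "t \<in> S" if "min u v \<le> t" "t \<le> max u v" for t using that S by auto
  consider "u < v" | "v < u" using \<open>u \<noteq> v\<close> by linarith
  then show ?thesis
  proof cases
    case 1
    with in_S deriv obtain t where t: "u < t" "t < v" "f v - f u = (v - u) * f' t"
      using MVT2[of u v f f'] by (metis less_imp_le max_def min_def not_le)
    then have "f' u < f' t" using in_S 1 by (intro strict_mono_onD[OF mono]) auto
    then have "(v - u) * f' u < (v - u) * f' t" using 1 by simp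
    with t(3) show ?thesis by (simp add: algebra_simps)
  next
    case 2
    with in_S deriv obtain t where t: "v < t" "t < u" "f u - f v = (u - v) * f' t"
      using MVT2[of v u f f'] by (metis less_imp_le max_def min_def not_le)
    then have "f' t < f' u" using in_S 2 by (intro strict_mono_onD[OF mono]) auto
    then have "(u - v) * f' t < (u - v) * f' u" using 2 by simp
    with t(3) show ?thesis by (simp add: algebra_simps)
  qed
qed

text \<open>The rational terms produced by the two logarithms cancel and leave the logarithm of a
  quotient of linear factors. This is why force balance exponentiates to a product identity.\<close>

lemma unit_potential_deriv:
  assumes "1 < \<bar>u\<bar>"
  shows "(unit_potential 0 has_real_derivative - (ln ((u + 1) / (u - 1)) / 2)) (at u)"
proof -
  have pos: "0 < (u + 1) / (u - 1)" "0 < (u + 1) * (u - 1)" "u - 1 \<noteq> 0" "u + 1 \<noteq> 0"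
    using assms by (auto simp: zero_less_divide_iff zero_less_mult_iff abs_if split: if_splits)
  have "((\<lambda>y. (y + 1) / (y - 1)) has_real_derivative (u - 1 - (u + 1)) / ((u - 1) * (u - 1))) (at u)"
    by (rule derivative_eq_intros refl pos)+ simp
  from DERIV_chain2[OF DERIV_ln_divide[OF pos(1)] this]
  have d1: "((\<lambda>y. ln ((y + 1) / (y - 1))) has_real_derivative - (2 / ((u + 1) * (u - 1)))) (at u)"
    by (rule DERIV_cong) (use pos in \<open>simp add: divide_simps\<close>)
  have "((\<lambda>y. (y + 1) * (y - 1)) has_real_derivative 2 * u) (at u)"
    by (rule derivative_eq_intros refl)+ simp
  from DERIV_chain2[OF DERIV_ln_divide[OF pos(2)] this]
  have d2: "((\<lambda>y. ln ((y + 1) * (y - 1))) has_real_derivative 2 * u / ((u + 1) * (u - 1))) (at u)"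
    by (rule DERIV_cong) simp
  have "((\<lambda>y. - (1 / 2) * (y * ln ((y + 1) / (y - 1))) - 1 / 2 * ln ((y + 1) * (y - 1)))
      has_real_derivative - (1 / 2) * (1 * ln ((u + 1) / (u - 1)) + - (2 / ((u + 1) * (u - 1))) * u) -
        1 / 2 * (2 * u / ((u + 1) * (u - 1)))) (at u)"
    by (intro DERIV_diff DERIV_cmult DERIV_mult DERIV_ident d1 d2)
  moreover have "- (1 / 2) * (1 * ln ((u + 1) / (u - 1)) + - (2 / ((u + 1) * (u - 1))) * u) -
        1 / 2 * (2 * u / ((u + 1) * (u - 1))) = - (ln ((u + 1) / (u - 1)) / 2)"
    by (simp add: diff_divide_distrib)
  ultimately show ?thesis
    unfolding unit_potential_def[abs_def] by simp
qed

lemma unit_potential_shift: "unit_potential x y = unit_potential 0 (y - x)"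
  by (simp add: unit_potential_def)

text \<open>The quotient is 1 + 2 / (u - 1), positive for |u| > 1 and decreasing on either side of
  its pole. Convexity does not extend across the excluded zone, hence the two cases for
  \<open>S\<close>.\<close>

lemma unit_potential_force_mono:
  fixes S :: "real set"
  assumes "S = {1<..} \<or> S = {..<-1}"
  shows "strict_mono_on S (\<lambda>u. - (ln ((u + 1) / (u - 1)) / 2))"
proof (rule strict_mono_onI)
  fix u v :: real assume uv: "u \<in> S" "v \<in> S" "u < v"
  with assms have same: "(1 < u \<and> 1 < v) \<or> (u < -1 \<and> v < -1)" by auto
  then have pos: "0 < (v + 1) / (v - 1)" "0 < (u - 1) * (v - 1)"
    by (auto simp: zero_less_divide_iff zero_less_mult_iff)
  have eq: "(v + 1) / (v - 1) = (u + 1) / (u - 1) - 2 * (v - u) / ((u - 1) * (v - 1))"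
  proof -
    have "u - 1 \<noteq> 0" "v - 1 \<noteq> 0" using same by auto
    then show ?thesis by (simp add: divide_simps) algebra
  qed
  have "(v + 1) / (v - 1) < (u + 1) / (u - 1)"
    unfolding eq using pos(2) uv(3) by (simp add: divide_pos_pos)
  with pos(1) show "- (ln ((u + 1) / (u - 1)) / 2) < - (ln ((v + 1) / (v - 1)) / 2)"
    by simp
qed

lemma unit_potential_tangent:
  assumes "(1 < u \<and> 1 < v) \<or> (u < -1 \<and> v < -1)"
  shows "unit_potential 0 u - ln ((u + 1) / (u - 1)) / 2 * (v - u) \<le> unit_potential 0 v"
proof (cases "u = v")
  case False
  define S :: "real set" where "S = (if 1 < u then {1<..} else {..<-1})"
  have "unit_potential 0 u + (- (ln ((u + 1) / (u - 1)) / 2)) * (v - u) < unit_potential 0 v"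
  proof (rule strict_tangent_below[where S = S])
    show "strict_mono_on S (\<lambda>u. - (ln ((u + 1) / (u - 1)) / 2))"
      by (rule unit_potential_force_mono) (simp add: S_def)
  qed (use assms False in \<open>auto simp: S_def intro!: unit_potential_deriv split: if_splits\<close>)
  then show ?thesis by simp
qed simp

lemma sum_off_diagonal_swap:
  assumes "finite I"
  shows "(\<Sum>j\<in>I. \<Sum>k\<in>I - {j}. f j k) = (\<Sum>j\<in>I. \<Sum>k\<in>I - {j}. f k j)"
proof -
  have "I - {j} = {k \<in> I. k \<noteq> j}" "I - {j} = {k \<in> I. j \<noteq> k}" for j by auto
  with sum.swap_restrict[OF assms assms, of f "\<lambda>j k. k \<noteq> j"] show ?thesis by simp
qed

text \<open>Every interaction term lies above its tangent; the tangent terms add up to twice the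
  total force tested against the displacement \<open>y - x\<close>, which vanishes in a balanced configuration.\<close>

lemma energy_tangent:
  fixes x y :: "nat \<Rightarrow> real"
  assumes same_side: "\<And>j k. j \<in> {1..m} \<Longrightarrow> k \<in> {1..m} \<Longrightarrow> j \<noteq> k \<Longrightarrow>
      (1 < x j - x k \<and> 1 < y j - y k) \<or> (x j - x k < -1 \<and> y j - y k < -1)"
    and balance: "\<And>j. j \<in> {1..m} \<Longrightarrow>
      (\<Sum>k\<in>{1..m} - {j}. ln ((x j - x k + 1) / (x j - x k - 1)) / 2) = - F j"
  shows "energy m \<phi> x + 2 * (\<Sum>j\<in>{1..m}. \<phi> (y j) - \<phi> (x j) + F j * (y j - x j)) \<le> energy m \<phi> y"
proof -
  define a where "a j k = ln ((x j - x k + 1) / (x j - x k - 1)) / 2" for j k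
  define h where "h j = y j - x j" for j
  let ?I = "{1..m}"
  have a_anti: "a k j = - a j k" for j k
  proof -
    have "(x k - x j + 1) / (x k - x j - 1) = inverse ((x j - x k + 1) / (x j - x k - 1))"
      unfolding inverse_divide by (subst minus_divide_divide[symmetric]) (simp add: algebra_simps)
    then show ?thesis by (simp only: a_def ln_inverse)
  qed
  have swap: "(\<Sum>j\<in>?I. \<Sum>k\<in>?I - {j}. a j k * h k) = - (\<Sum>j\<in>?I. \<Sum>k\<in>?I - {j}. a j k * h j)"
  proof -
    have "(\<Sum>j\<in>?I. \<Sum>k\<in>?I - {j}. a j k * h k) = (\<Sum>j\<in>?I. \<Sum>k\<in>?I - {j}. a k j * h j)"
      by (rule sum_off_diagonal_swap) simp
    also have "\<dots> = (\<Sum>j\<in>?I. \<Sum>k\<in>?I - {j}. - (a j k * h j))"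
      by (intro sum.cong refl) (metis a_anti mult_minus_left)
    finally show ?thesis by (simp only: sum_negf)
  qed
  have "(\<Sum>j\<in>?I. \<Sum>k\<in>?I - {j}. a j k * (h j - h k)) = 2 * (\<Sum>j\<in>?I. \<Sum>k\<in>?I - {j}. a j k * h j)"
    unfolding right_diff_distrib sum_subtractf swap by simp
  also have "(\<Sum>j\<in>?I. \<Sum>k\<in>?I - {j}. a j k * h j) = (\<Sum>j\<in>?I. - F j * h j)"
    unfolding sum_distrib_right[symmetric] using balance by (intro sum.cong) (simp_all add: a_def)
  finally have virial: "(\<Sum>j\<in>?I. \<Sum>k\<in>?I - {j}. a j k * (h j - h k)) = 2 * (\<Sum>j\<in>?I. - F j * h j)" .
  have "(\<Sum>j\<in>?I. \<Sum>k\<in>?I - {j}. unit_potential (x k) (x j) - a j k * (h j - h k)) \<le>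
      (\<Sum>j\<in>?I. \<Sum>k\<in>?I - {j}. unit_potential (y k) (y j))"
  proof (intro sum_mono)
    fix j k assume "j \<in> ?I" "k \<in> ?I - {j}"
    then have "unit_potential 0 (x j - x k) -
        ln ((x j - x k + 1) / (x j - x k - 1)) / 2 * ((y j - y k) - (x j - x k)) \<le>
      unit_potential 0 (y j - y k)"
      using same_side[of j k] by (intro unit_potential_tangent) auto
    moreover have "(y j - y k) - (x j - x k) = h j - h k" by (simp add: h_def)
    ultimately show "unit_potential (x k) (x j) - a j k * (h j - h k) \<le> unit_potential (y k) (y j)"
      unfolding unit_potential_shift[of "x k"] unit_potential_shift[of "y k"] a_def by simp
  qed
  then have "(\<Sum>j\<in>?I. \<Sum>k\<in>?I - {j}. unit_potential (x k) (x j)) - 2 * (\<Sum>j\<in>?I. - F j * h j) \<le>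
      (\<Sum>j\<in>?I. \<Sum>k\<in>?I - {j}. unit_potential (y k) (y j))"
    unfolding sum_subtractf virial .
  then show ?thesis
    unfolding energy_def by (simp add: sum.distrib sum_subtractf sum_negf h_def)
qed

text \<open>Makes the energy of distinct points a function of the point set alone, so that the roots
  may be labelled as a competitor requires.\<close>

lemma energy_reindex:
  assumes "inj_on x {1..m}"
  shows "energy m \<phi> x =
    (\<Sum>a\<in>x ` {1..m}. \<Sum>b\<in>x ` {1..m} - {a}. unit_potential b a) + 2 * (\<Sum>a\<in>x ` {1..m}. \<phi> a)"
proof -
  have "(\<Sum>b\<in>x ` {1..m} - {x j}. unit_potential b (x j)) =
      (\<Sum>k\<in>{1..m} - {j}. unit_potential (x k) (x j))" if "j \<in> {1..m}" for j
  proof -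
    have "x ` {1..m} - {x j} = x ` ({1..m} - {j})"
      using assms that by (auto dest: inj_onD)
    then show ?thesis using assms by (simp add: sum.reindex inj_on_diff)
  qed
  then show ?thesis
    unfolding energy_def by (simp add: sum.reindex[OF assms] del: One_nat_def)
qed

lemma sorted_list_of_set_nth_less:
  fixes A :: "'a::linorder set"
  assumes "i < j" "j < card A"
  shows "sorted_list_of_set A ! i < sorted_list_of_set A ! j"
  using strict_sorted_list_of_set[of A] assms
  by (metis length_sorted_list_of_set sorted_wrt_nth_less)

text \<open>Index j is sent to the element of \<open>X\<close> whose rank equals the rank of
  \<open>z j\<close> among the values of \<open>z\<close>. This lists the roots in the order of a
  given competitor.\<close>

lemma ex_order_isomorphic_bij:
  fixes z :: "'a \<Rightarrow> 'b::linorder" and X :: "'c::linorder set"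
  assumes "finite A" "inj_on z A" "card X = card A" "finite X"
  shows "\<exists>x. bij_betw x A X \<and> (\<forall>j\<in>A. \<forall>k\<in>A. z j < z k \<longrightarrow> x j < x k)"
proof -
  define rank where "rank j = card {i \<in> A. z i < z j}" for j
  define x where "x j = sorted_list_of_set X ! rank j" for j
  have rank_less: "rank j < rank k" if "j \<in> A" "k \<in> A" "z j < z k" for j k
    unfolding rank_def using that assms(1) by (intro psubset_card_mono) auto
  have rank_bound: "rank j < card X" if "j \<in> A" for j
    unfolding rank_def assms(3) using that assms(1) by (intro psubset_card_mono) auto
  have less: "x j < x k" if "j \<in> A" "k \<in> A" "z j < z k" for j k
    unfolding x_def using rank_less[OF that] rank_bound[OF that(2)]
    by (rule sorted_list_of_set_nth_less)
  have inj: "inj_on x A"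
  proof (rule inj_onI)
    fix j k assume "j \<in> A" "k \<in> A" "x j = x k"
    then show "j = k" using less[of j k] less[of k j] assms(2)
      by (metis inj_onD less_irrefl neq_iff)
  qed
  have "x ` A \<subseteq> X"
    using rank_bound assms(4) nth_mem[of _ "sorted_list_of_set X"] by (auto simp: x_def)
  then have "x ` A = X" using inj assms by (intro card_subset_eq) (auto simp: card_image)
  with inj less show ?thesis by (auto simp: bij_betw_def)
qed

section \<open>Comparison of critical configurations\<close>

text \<open>The exponential of twice the joint repulsion on \<open>a\<close> by \<open>r\<close> and
  by its mirror image -\<sigma> - r.\<close>

definition gap_factor :: "real \<Rightarrow> real \<Rightarrow> real \<Rightarrow> real" where
  "gap_factor \<sigma> a r = (a - r + 1) / (a - r - 1) * ((a + r + \<sigma> + 1) / (a + r + \<sigma> - 1))"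

context
  fixes \<sigma> :: real
  assumes sigma: "1 \<le> \<sigma>"
begin

lemma gap_factor_pos:
  assumes "0 < a" "0 < r" "1 < \<bar>a - r\<bar>"
  shows "0 < gap_factor \<sigma> a r"
  unfolding gap_factor_def using assms sigma
  by (intro mult_pos_pos) (auto simp: zero_less_divide_iff abs_if split: if_splits)

lemma gap_factor_eq:
  assumes "0 < a" "0 < r" "1 < \<bar>a - r\<bar>"
  shows "gap_factor \<sigma> a r = 1 + 2 * (2 * a + \<sigma>) / ((a - r - 1) * (a + r + \<sigma> - 1))"
proof -
  have nz: "a - r - 1 \<noteq> 0" "a + r + \<sigma> - 1 \<noteq> 0" using assms sigma by auto
  have "(a - r + 1) * (a + r + \<sigma> + 1) = (a - r - 1) * (a + r + \<sigma> - 1) + 2 * (2 * a + \<sigma>)"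
    by (simp add: algebra_simps)
  then have "gap_factor \<sigma> a r =
      ((a - r - 1) * (a + r + \<sigma> - 1) + 2 * (2 * a + \<sigma>)) / ((a - r - 1) * (a + r + \<sigma> - 1))"
    by (simp add: gap_factor_def)
  also have "\<dots> = 1 + 2 * (2 * a + \<sigma>) / ((a - r - 1) * (a + r + \<sigma> - 1))"
    unfolding add_divide_distrib using nz by simp
  finally show ?thesis .
qed

text \<open>By \<open>gap_factor_eq\<close> the variable r enters only through a denominator that
  decreases in r. The last hypothesis keeps \<open>r\<close> and \<open>q\<close> on the same side
  of \<open>a\<close>, so the denominator keeps its sign and its reciprocal grows.\<close>

lemma gap_factor_mono:
  assumes "0 < a" "0 < r" "r \<le> q" "1 < a - q \<or> a - r < -1"
  shows "gap_factor \<sigma> a r \<le> gap_factor \<sigma> a q"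
proof -
  let ?D = "\<lambda>r. (a - r - 1) * (a + r + \<sigma> - 1)"
  have "?D r - ?D q = (q - r) * (q + r + \<sigma>)" by (simp add: algebra_simps)
  also have "\<dots> \<ge> 0" using assms sigma by simp
  finally have "?D q \<le> ?D r" by simp
  moreover have "0 < ?D r * ?D q"
    using assms sigma by (auto simp: zero_less_mult_iff mult_less_0_iff)
  ultimately have "inverse (?D r) \<le> inverse (?D q)"
    by (metis le_imp_inverse_le le_imp_inverse_le_neg zero_less_mult_iff)
  then have "2 * (2 * a + \<sigma>) * inverse (?D r) \<le> 2 * (2 * a + \<sigma>) * inverse (?D q)"
    using assms sigma by (intro mult_left_mono) auto
  then show ?thesis using assms
    by (subst (1 2) gap_factor_eq) (auto simp: divide_inverse)
qed

text \<open>A common translation preserves a - r but moves \<open>a\<close> away from the mirror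
  image of \<open>r\<close>, weakening that repulsion.\<close>

lemma gap_factor_shift:
  assumes "0 < a" "0 < r" "0 \<le> t" "1 < \<bar>a - r\<bar>"
  shows "gap_factor \<sigma> (a + t) (r + t) \<le> gap_factor \<sigma> a r"
proof -
  have "(a + t + (r + t) + \<sigma> + 1) / (a + t + (r + t) + \<sigma> - 1) = 1 + 2 / (a + r + 2 * t + \<sigma> - 1)"
    using assms sigma by (simp add: field_simps)
  also have "\<dots> \<le> 1 + 2 / (a + r + \<sigma> - 1)"
    using assms sigma by (intro add_left_mono divide_left_mono mult_pos_pos) auto
  also have "\<dots> = (a + r + \<sigma> + 1) / (a + r + \<sigma> - 1)"
    using assms sigma by (simp add: field_simps)
  finally have le: "(a + t + (r + t) + \<sigma> + 1) / (a + t + (r + t) + \<sigma> - 1) \<le>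
      (a + r + \<sigma> + 1) / (a + r + \<sigma> - 1)" .
  have "0 \<le> (a - r + 1) / (a - r - 1)"
    using assms(4) by (auto simp: zero_le_divide_iff abs_if split: if_splits)
  from mult_left_mono[OF le this] show ?thesis
    unfolding gap_factor_def add_diff_cancel_right .
qed

text \<open>The displacement is a translation of both points by a' - a followed by moving the second
  point down to r'. Neither step raises the factor.\<close>

lemma gap_factor_displaced:
  assumes "0 < a" "0 < r" "0 < a'" "0 < r'" "a \<le> a'" "r' - r \<le> a' - a"
    "(1 < a - r \<and> 1 < a' - r') \<or> (a - r < -1 \<and> a' - r' < -1)"
  shows "gap_factor \<sigma> a' r' \<le> gap_factor \<sigma> a r"
proof -
  have "gap_factor \<sigma> a' r' \<le> gap_factor \<sigma> a' (r + (a' - a))"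
    using assms by (intro gap_factor_mono) auto
  also have "\<dots> = gap_factor \<sigma> (a + (a' - a)) (r + (a' - a))" by simp
  also have "\<dots> \<le> gap_factor \<sigma> a r"
    using assms by (intro gap_factor_shift) auto
  finally show ?thesis .
qed

text \<open>A maximum principle, applied at an index where \<open>z j - x j\<close> is largest.\<close>

lemma critical_comparison:
  fixes x z :: "nat \<Rightarrow> real"
  assumes pos: "\<And>j. j < n \<Longrightarrow> 0 < x j" "\<And>j. j < n \<Longrightarrow> 0 < z j"
    and gaps: "\<And>j k. j < k \<Longrightarrow> k < n \<Longrightarrow> 1 < x k - x j" "\<And>j k. j < k \<Longrightarrow> k < n \<Longrightarrow> 1 < z k - z j"
    and crit: "\<And>j. j < n \<Longrightarrow> (\<Prod>k\<in>{..<n} - {j}. gap_factor \<sigma> (x j) (x k)) = g (x j)"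
      "\<And>j. j < n \<Longrightarrow> (\<Prod>k\<in>{..<n} - {j}. gap_factor \<sigma> (z j) (z k)) = h (z j)"
    and less: "\<And>j. j < n \<Longrightarrow> x j \<le> z j \<Longrightarrow> g (x j) < h (z j)"
    and i: "i < n"
  shows "z i < x i"
proof (rule ccontr)
  assume not: "\<not> z i < x i"
  obtain j where j: "j < n" and max: "\<And>k. k < n \<Longrightarrow> z k - x k \<le> z j - x j"
  proof -
    let ?D = "(\<lambda>k. z k - x k) ` {..<n}"
    have "finite ?D" "?D \<noteq> {}" using i by auto
    then have "Max ?D \<in> ?D" "\<And>k. k < n \<Longrightarrow> z k - x k \<le> Max ?D" by auto
    then show thesis using that by (metis (no_types, lifting) imageE lessThan_iff)
  qed
  \<comment> \<open>The displacement at \<open>i\<close> is nonnegative, hence so is the largest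
    one. Every other point is displaced by no more than point \<open>j\<close>, so each factor can
    only drop.\<close>
  have le: "x j \<le> z j" using max[OF i] not by linarith
  have "h (z j) \<le> g (x j)"
    unfolding crit(1)[OF j, symmetric] crit(2)[OF j, symmetric]
  proof (rule prod_mono)
    fix k assume k: "k \<in> {..<n} - {j}"
    then have sides: "(1 < x j - x k \<and> 1 < z j - z k) \<or> (x j - x k < -1 \<and> z j - z k < -1)"
      using gaps[of j k] gaps[of k j] j by (cases j k rule: linorder_cases) auto
    then show "0 \<le> gap_factor \<sigma> (z j) (z k) \<and> gap_factor \<sigma> (z j) (z k) \<le> gap_factor \<sigma> (x j) (x k)"
      using k j pos[of j] pos[of k] le max[of k]
      by (auto intro!: gap_factor_displaced less_imp_le[OF gap_factor_pos])
  qed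
  with less[OF j le] show False by linarith
qed

end

section \<open>Zeros of Racah polynomials as critical points\<close>

lemma divide_le_cross: "0 < b \<Longrightarrow> 0 < d \<Longrightarrow> a * d \<le> c * b \<Longrightarrow> a / b \<le> c / d" for a b c d :: real
  by (simp add: divide_simps)

lemma divide_less_cross: "0 < b \<Longrightarrow> 0 < d \<Longrightarrow> a * d < c * b \<Longrightarrow> a / b < c / d" for a b c d :: real
  by (simp add: divide_simps)

lemma index_blocks: "{1..2 * n} = {1..n} \<union> {n+1..2*n}" for n :: nat
  by auto

context racah_params
begin

definition ratio :: "real \<Rightarrow> real" where
  "ratio x = x * (\<beta> - \<gamma> - x) * (x + \<delta>) * (x + real N + s) /
    ((real N - x) * (x + \<gamma> + 1) * (x + \<beta> + \<delta> + 1) * (x + s))"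

text \<open>\<open>force_ratio\<close> is \<open>d/b\<close>; \<open>ratio\<close> omits the self-interaction of a root with its mirror image.\<close>

definition force_ratio :: "real \<Rightarrow> real" where
  "force_ratio x = ratio x * ((2 * x + s + 1) / (2 * x + s - 1))"

lemma ratio_pos: "0 < x \<Longrightarrow> x < real N \<Longrightarrow> 0 < ratio x"
  unfolding ratio_def using gamma_nonneg delta_nonneg beta_gt
  by (intro divide_pos_pos mult_pos_pos) linarith+

lemma force_ratio_pos: "0 < x \<Longrightarrow> x < real N \<Longrightarrow> 0 < force_ratio x"
  unfolding force_ratio_def using gamma_nonneg delta_nonneg
  by (intro divide_pos_pos mult_pos_pos ratio_pos) linarith+

lemma death_eq_ratio_birth:
  assumes "0 < x" "x < real N"
  shows "death x * (2 * x + s - 1) = ratio x * (birth x * (2 * x + s + 1))"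
proof -
  define A B where "A = x * (\<beta> - \<gamma> - x) * (x + \<delta>) * (x + real N + s)"
    and "B = (real N - x) * (x + \<gamma> + 1) * (x + \<beta> + \<delta> + 1) * (x + s)"
  define u v w where "u = 2 * x + s - 1" and "v = 2 * x + s" and "w = 2 * x + s + 1"
  have "0 < B" unfolding B_def using assms gamma_nonneg delta_nonneg beta_gt
    by (intro mult_pos_pos) linarith+
  moreover have "0 < u" "0 < v" "0 < w"
    using assms gamma_nonneg delta_nonneg unfolding u_def v_def w_def by linarith+
  moreover have "death x = A / (u * v)" "birth x = B / (v * w)" "ratio x = A / B"
    unfolding death_def birth_def ratio_def A_def B_def u_def v_def w_def by (simp_all only: ac_simps)
  ultimately show ?thesis unfolding u_def[symmetric] w_def[symmetric] by simp
qed

lemma X_gap: "n \<le> N \<Longrightarrow> a \<in> X n \<Longrightarrow> r \<in> X n \<Longrightarrow> a \<noteq> r \<Longrightarrow> 1 < \<bar>a - r\<bar>"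
  using root_gap[of n a r] root_gap[of n r a] by (cases a r rule: linorder_cases) auto

lemma X_bounds: "a \<in> X n \<Longrightarrow> 0 < a \<and> a < real N"
  by (simp add: X_def)

lemma s_ge_1: "1 \<le> s"
  using gamma_nonneg delta_nonneg by simp

text \<open>In y(a + 1) / y(a - 1) the factor belonging to \<open>a\<close> itself is -(2a + s + 1)
  / (2a + s - 1). It absorbs the sign in the root equation and the mirror factor of
  \<open>death\<close> over \<open>birth\<close>; the remaining factors are the gap factors.\<close>

lemma critical_ratio:
  assumes n: "n \<le> N" and a: "a \<in> X n"
  shows "(\<Prod>r\<in>X n - {a}. gap_factor s a r) = ratio a"
proof -
  define U where "U = (\<Prod>r\<in>X n - {a}. (a + 1 - r) * (a + 1 + r + s))"
  define V where "V = (\<Prod>r\<in>X n - {a}. (a - 1 - r) * (a - 1 + r + s))"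
  define C where "C = lead_coeff (R n)"
  have C: "C \<noteq> 0" unfolding C_def by (rule lead_coeff_R[OF n])
  have fin: "finite (X n)" by (rule finite_X[OF n])
  have a0: "0 < a" "a < real N" using X_bounds[OF a] by auto
  have plus: "poly (P n) (a + 1) = C * ((2 * a + s + 1) * U)"
  proof -
    have "(a + 1 - a) * (a + 1 + a + s) = 2 * a + s + 1" by simp
    then show ?thesis
      unfolding poly_P_factored[OF n] C_def U_def prod.remove[OF fin a] by (simp only:)
  qed
  have minus: "poly (P n) (a - 1) = - (C * ((2 * a + s - 1) * V))"
  proof -
    have "(a - 1 - a) * (a - 1 + a + s) = - (2 * a + s - 1)" by simp
    then show ?thesis
      unfolding poly_P_factored[OF n] C_def V_def prod.remove[OF fin a]
      by (simp only: mult_minus_left mult_minus_right)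
  qed
  have "(a - 1 - r) * (a - 1 + r + s) \<noteq> 0" if r: "r \<in> X n - {a}" for r
  proof -
    from r have "1 < \<bar>a - r\<bar>" using X_gap[OF n a, of r] by auto
    moreover have "0 < r" using X_bounds r by auto
    then have "a - 1 + r + s \<noteq> 0" using a0 s_ge_1 by linarith
    ultimately show ?thesis by auto
  qed
  then have V: "V \<noteq> 0"
    unfolding V_def using fin by (subst prod_zero_iff) blast+
  have K: "birth a * (2 * a + s + 1) \<noteq> 0" (is "?K \<noteq> 0")
    using birth_pos[of a] a0 s_ge_1 by simp
  have "C * (U * ?K) = C * (V * (death a * (2 * a + s - 1)))"
    using root_equation[OF n a] unfolding plus minus
    by (simp only: mult_minus_right add_uminus_conv_diff right_minus_eq ac_simps)
  then have "U * ?K = V * (ratio a * ?K)"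
    unfolding death_eq_ratio_birth[OF a0] using C by (simp only: mult_cancel_left simp_thms)
  then have "U * ?K = (V * ratio a) * ?K" by (simp only: mult.assoc)
  then have "U = V * ratio a" using K by (simp only: mult_cancel_right simp_thms)
  moreover have "(\<Prod>r\<in>X n - {a}. gap_factor s a r) = U / V"
    unfolding U_def V_def prod_dividef[symmetric] gap_factor_def times_divide_times_eq
    by (intro prod.cong refl arg_cong2[of _ _ _ _ "(/)"] arg_cong2[of _ _ _ _ "(*)"]) auto
  ultimately show ?thesis using V by simp
qed

subsection \<open>The external force\<close>

text \<open>The argument of the logarithm is the reciprocal of \<open>death\<close> over
  \<open>birth\<close>. The factors \<open>x - N\<close> and \<open>x - \<beta> + \<gamma>\<close>,
  negative on (0, N), stand on opposite sides of the fraction, so their signs cancel.\<close>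

lemma racah_force_eq: "racah_force (- real N - 1) \<beta> \<gamma> \<delta> x = - (ln (force_ratio x) / 2)"
proof -
  have eqs: "x + (- real N - 1) + 1 = - (real N - x)" "x - \<beta> + \<gamma> = - (\<beta> - \<gamma> - x)"
    "x + \<gamma> + \<delta> + 1 = x + s" "x - (- real N - 1) + \<gamma> + \<delta> = x + real N + s"
    "2 * x + \<gamma> + \<delta> = 2 * x + s - 1" "2 * x + s - 1 + 2 = 2 * x + s + 1" by auto
  have cross: "(- p * q * t * w * c) / (x * - b * d * e * f) =
      inverse (x * b * d * e / (p * q * t * w) * (f / c))" for p q t w c b d e f :: real
    by simp
  show ?thesis
    unfolding racah_force_def eqs cross force_ratio_def ratio_def ln_inverse
    by (simp only: mult_minus_right mult_1 times_divide_eq_left)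
qed

text \<open>Up to signs, the reflection exchanges the factors of numerator and denominator. This
  transfers balance and monotonicity to the mirror interval.\<close>

lemma racah_force_reflect:
  "racah_force (- real N - 1) \<beta> \<gamma> \<delta> (- s - x) = - racah_force (- real N - 1) \<beta> \<gamma> \<delta> x"
proof -
  let ?y = "- s - x"
  have eqs: "?y + (- real N - 1) + 1 = - (x + real N + s)" "?y + \<gamma> + 1 = - (x + \<delta>)"
    "?y + \<beta> + \<delta> + 1 = \<beta> - \<gamma> - x" "?y + \<gamma> + \<delta> + 1 = - x"
    "2 * ?y + \<gamma> + \<delta> = - (2 * x + s + 1)" "?y - \<beta> + \<gamma> = - (x + \<beta> + \<delta> + 1)"
    "?y + \<delta> = - (x + \<gamma> + 1)" "?y - (- real N - 1) + \<gamma> + \<delta> = real N - x"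
    "- (2 * x + s + 1) + 2 = - (2 * x + s - 1)" by auto
  have y: "?y = - (x + s)" by simp
  have cross: "(- e * - d * b * - x * - f) / (- w * - t * - q * p * - c) =
      x * b * d * e / (p * q * t * w) * (f / c)" for p q t c b d e f w :: real
    by (simp add: ac_simps)
  have "racah_force (- real N - 1) \<beta> \<gamma> \<delta> ?y = 1 / 2 * ln (force_ratio x)"
    unfolding racah_force_def eqs unfolding y cross force_ratio_def ratio_def ..
  then show ?thesis unfolding racah_force_eq[of x] by simp
qed

text \<open>A quotient (x + p) / (x + q) with positive denominator increases when p \<le> q. For the
  second quotient this condition is \<gamma> + N \<le> \<beta>.\<close>

lemma middle_factors_mono:
  assumes "0 < x" "x < y" "y < real N"
  shows "(x + \<delta>) / (x + s) * ((x + real N + s) / (x + \<beta> + \<delta> + 1)) \<le>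
    (y + \<delta>) / (y + s) * ((y + real N + s) / (y + \<beta> + \<delta> + 1))"
proof (rule mult_mono)
  have "0 \<le> (y - x) * (s - \<delta>)" using assms gamma_nonneg by (intro mult_nonneg_nonneg) auto
  then show "(x + \<delta>) / (x + s) \<le> (y + \<delta>) / (y + s)"
    using assms gamma_nonneg delta_nonneg by (intro divide_le_cross) (auto simp: algebra_simps)
  have "0 \<le> (y - x) * (\<beta> - \<gamma> - real N)" using assms beta_gt by (intro mult_nonneg_nonneg) auto
  then show "(x + real N + s) / (x + \<beta> + \<delta> + 1) \<le> (y + real N + s) / (y + \<beta> + \<delta> + 1)"
    using assms gamma_nonneg delta_nonneg beta_gt
    by (intro divide_le_cross) (auto simp: algebra_simps)
qed (use assms gamma_nonneg delta_nonneg beta_gt in \<open>auto intro!: divide_nonneg_nonneg\<close>)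

lemma last_factor_strict_mono:
  assumes "0 < x" "x < y" "y < real N"
  shows "(\<beta> - \<gamma> - x) / (real N - x) < (\<beta> - \<gamma> - y) / (real N - y)"
proof -
  have "0 < (y - x) * (\<beta> - \<gamma> - real N)" using assms beta_gt by (intro mult_pos_pos) auto
  then show ?thesis using assms by (intro divide_less_cross) (auto simp: algebra_simps)
qed

text \<open>The common part of \<open>ratio\<close> and \<open>force_ratio\<close>, which differ
  only in the first factor \<open>A\<close>. Strictness comes from the last factor, which equals 1 +
  (\<beta> - \<gamma> - N) / (N - x).\<close>

lemma weighted_product_strict_mono:
  assumes "0 < x" "x < y" "y < real N" "0 < A x" "A x \<le> A y"
  shows "A x * ((x + \<delta>) / (x + s) * ((x + real N + s) / (x + \<beta> + \<delta> + 1))) *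
      ((\<beta> - \<gamma> - x) / (real N - x)) <
    A y * ((y + \<delta>) / (y + s) * ((y + real N + s) / (y + \<beta> + \<delta> + 1))) *
      ((\<beta> - \<gamma> - y) / (real N - y))"
proof (rule mult_le_less_imp_less)
  show "A x * ((x + \<delta>) / (x + s) * ((x + real N + s) / (x + \<beta> + \<delta> + 1))) \<le>
    A y * ((y + \<delta>) / (y + s) * ((y + real N + s) / (y + \<beta> + \<delta> + 1)))"
    using assms gamma_nonneg delta_nonneg beta_gt
    by (intro mult_mono middle_factors_mono mult_nonneg_nonneg divide_nonneg_nonneg) auto
  show "(\<beta> - \<gamma> - x) / (real N - x) < (\<beta> - \<gamma> - y) / (real N - y)"
    using assms(1-3) by (rule last_factor_strict_mono)
  show "0 < A x * ((x + \<delta>) / (x + s) * ((x + real N + s) / (x + \<beta> + \<delta> + 1)))"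
    using assms gamma_nonneg delta_nonneg beta_gt by (intro mult_pos_pos divide_pos_pos) auto
  show "0 \<le> (\<beta> - \<gamma> - x) / (real N - x)"
    using assms beta_gt by (intro divide_nonneg_nonneg) auto
qed

lemma ratio_split:
  "ratio x = x / (x + \<gamma> + 1) * ((x + \<delta>) / (x + s) * ((x + real N + s) / (x + \<beta> + \<delta> + 1))) *
      ((\<beta> - \<gamma> - x) / (real N - x))"
  unfolding ratio_def times_divide_times_eq by (simp only: ac_simps)

lemma ratio_strict_mono:
  assumes "0 < x" "x < y" "y < real N"
  shows "ratio x < ratio y"
proof -
  have "0 \<le> (y - x) * (\<gamma> + 1)" using assms gamma_nonneg by (intro mult_nonneg_nonneg) auto
  then have "x / (x + \<gamma> + 1) \<le> y / (y + \<gamma> + 1)"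
    using assms gamma_nonneg by (intro divide_le_cross) (auto simp: algebra_simps)
  with assms gamma_nonneg show ?thesis
    unfolding ratio_split by (intro weighted_product_strict_mono[where A = "\<lambda>x. x / (x + \<gamma> + 1)"]) auto
qed

text \<open>The mirror factor (2x + s + 1) / (2x + s - 1) decreases, so it cannot be treated
  separately. Paired with x / (x + \<gamma> + 1) it gives a nondecreasing \<open>A\<close>, constant
  for \<gamma> = \<delta> = 0.\<close>

lemma force_ratio_strict_mono:
  assumes "0 < x" "x < y" "y < real N"
  shows "force_ratio x < force_ratio y"
proof -
  define A where "A x = x * (2 * x + s + 1) / ((x + \<gamma> + 1) * (2 * x + s - 1))" for x
  have split: "force_ratio x = A x * ((x + \<delta>) / (x + s) * ((x + real N + s) / (x + \<beta> + \<delta> + 1))) *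
      ((\<beta> - \<gamma> - x) / (real N - x))" for x
    unfolding force_ratio_def ratio_split A_def times_divide_times_eq by (simp only: ac_simps)
  have pos: "0 < (t + \<gamma> + 1) * (2 * t + s - 1)" "0 < t * (2 * t + s + 1)" if "0 < t" for t
    using that gamma_nonneg delta_nonneg by (intro mult_pos_pos; simp)+
  have "A x \<le> A y"
    unfolding A_def
  proof (rule divide_le_cross)
    \<comment> \<open>The numerator of \<open>A y - A x\<close> over the common denominator,
      arranged as a sum of nonnegative terms.\<close>
    have "0 \<le> 2 * \<gamma> * (2 * (x * y) * (y - x)) +
        (\<gamma> + 1) * (\<gamma> + \<delta>) * ((y - x) * (2 * (x + y) + s + 1))"
      using assms gamma_nonneg delta_nonneg by (intro add_nonneg_nonneg mult_nonneg_nonneg) auto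
    also have "\<dots> = y * (2 * y + s + 1) * ((x + \<gamma> + 1) * (2 * x + s - 1)) -
        x * (2 * x + s + 1) * ((y + \<gamma> + 1) * (2 * y + s - 1))"
      by algebra
    finally show "x * (2 * x + s + 1) * ((y + \<gamma> + 1) * (2 * y + s - 1)) \<le>
        y * (2 * y + s + 1) * ((x + \<gamma> + 1) * (2 * x + s - 1))" by simp
  qed (use pos assms in auto)
  moreover have "0 < A x" unfolding A_def using pos[OF assms(1)] by (intro divide_pos_pos)
  ultimately show ?thesis
    unfolding split using assms by (intro weighted_product_strict_mono) auto
qed

section \<open>Mirror images of the roots and balance of forces\<close>

definition Y :: "nat \<Rightarrow> real set" where
  "Y n = {x \<in> {- real N - \<gamma> - \<delta> - 1<..<- \<gamma> - \<delta> - 1}. poly (P n) x = 0}"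

lemma Y_eq_image: "Y n = (\<lambda>r. - s - r) ` X n"
proof (intro set_eqI iffI)
  fix y assume "y \<in> Y n"
  then have "- s - y \<in> X n" using poly_P[of n "- s - y"] poly_P[of n y] lam_reflect[of y]
    by (auto simp: Y_def X_def)
  then show "y \<in> (\<lambda>r. - s - r) ` X n" by (intro image_eqI[of _ _ "- s - y"]) auto
next
  fix y assume "y \<in> (\<lambda>r. - s - r) ` X n"
  then obtain r where r: "y = - s - r" "r \<in> X n" by auto
  then have "poly (P n) y = 0" using poly_P[of n y] poly_P[of n r] lam_reflect[of r]
    by (auto simp: X_def)
  then show "y \<in> Y n" using r X_bounds[OF r(2)] by (auto simp: Y_def)
qed

lemma Y_bounds: "y \<in> Y n \<Longrightarrow> - real N - s < y \<and> y < - s"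
  by (auto simp: Y_def)

lemma card_Y: "n \<le> N \<Longrightarrow> card (Y n) = n"
  unfolding Y_eq_image by (subst card_image) (auto simp: inj_on_def card_X)

lemma XY_disjoint: "X n \<inter> Y n = {}"
  using X_bounds Y_bounds s_ge_1 by force

lemma finite_Y: "n \<le> N \<Longrightarrow> finite (Y n)"
  by (simp add: Y_eq_image finite_X)

lemma XY_gap:
  assumes "n \<le> N" "a \<in> X n \<union> Y n" "b \<in> X n \<union> Y n" "a \<noteq> b"
  shows "1 < \<bar>a - b\<bar>"
proof -
  have XY: "1 < \<bar>u - v\<bar>" if "u \<in> X n" "v \<in> Y n" for u v
    using X_bounds[OF that(1)] Y_bounds[OF that(2)] s_ge_1 by linarith
  have YY: "1 < \<bar>u - v\<bar>" if "u \<in> Y n" "v \<in> Y n" "u \<noteq> v" for u v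
    using that X_gap[OF assms(1)] unfolding Y_eq_image by (auto simp: abs_minus_commute)
  from assms show ?thesis
    using X_gap[OF assms(1)] XY[of a b] XY[of b a] YY[of a b] by (auto simp: abs_minus_commute)
qed

text \<open>Each other root and its mirror image together contribute half the logarithm of a gap
  factor. The image of \<open>a\<close> itself contributes the term that turns \<open>ratio\<close>
  into \<open>force_ratio\<close>.\<close>

lemma balance_X:
  assumes n: "n \<le> N" and a: "a \<in> X n"
  shows "(\<Sum>r\<in>X n \<union> Y n - {a}. ln ((a - r + 1) / (a - r - 1)) / 2) =
    - racah_force (- real N - 1) \<beta> \<gamma> \<delta> a"
proof -
  let ?L = "\<lambda>r. ln ((a - r + 1) / (a - r - 1)) / 2"
  let ?M = "\<lambda>r. ln ((a + r + s + 1) / (a + r + s - 1)) / 2"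
  have fin: "finite (X n)" by (rule finite_X[OF n])
  have a0: "0 < a" "a < real N" using X_bounds[OF a] by auto
  have "a \<notin> Y n" using a XY_disjoint by auto
  then have "X n \<union> Y n - {a} = (X n - {a}) \<union> Y n" by auto
  then have "sum ?L (X n \<union> Y n - {a}) = sum ?L (X n - {a}) + sum ?L (Y n)"
    using XY_disjoint fin finite_Y[OF n] by (simp only:) (subst sum.union_disjoint, auto)
  also have "sum ?L (Y n) = sum ?M (X n)"
    unfolding Y_eq_image by (subst sum.reindex) (auto simp: inj_on_def algebra_simps)
  also have "\<dots> = ?M a + sum ?M (X n - {a})" by (rule sum.remove[OF fin a])
  also have "sum ?L (X n - {a}) + (?M a + sum ?M (X n - {a})) =
      ?M a + (\<Sum>r\<in>X n - {a}. ?L r + ?M r)" by (simp add: sum.distrib)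
  also have "(\<Sum>r\<in>X n - {a}. ?L r + ?M r) = (\<Sum>r\<in>X n - {a}. ln (gap_factor s a r)) / 2"
    unfolding sum_divide_distrib
  proof (rule sum.cong)
    fix r assume r: "r \<in> X n - {a}"
    then have gap: "1 < \<bar>a - r\<bar>" using X_gap[OF n a, of r] by auto
    have "0 < r" using r X_bounds by auto
    then have "0 < (a + r + s + 1) / (a + r + s - 1)"
      using a0 s_ge_1 by (intro divide_pos_pos) linarith+
    moreover have "0 < (a - r + 1) / (a - r - 1)"
      using gap by (auto simp: zero_less_divide_iff abs_if split: if_splits)
    ultimately show "?L r + ?M r = ln (gap_factor s a r) / 2"
      unfolding gap_factor_def by (simp only: ln_mult_pos add_divide_distrib)
  qed simp
  also have "(\<Sum>r\<in>X n - {a}. ln (gap_factor s a r)) = ln (ratio a)"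
    unfolding critical_ratio[OF n a, symmetric]
  proof (rule ln_prod[symmetric])
    show "gap_factor s a r \<noteq> 0" if "r \<in> X n - {a}" for r
      using that X_gap[OF n a, of r] X_bounds[of r n] a0
      by (intro less_imp_neq[THEN not_sym] gap_factor_pos s_ge_1) auto
  qed (use fin in auto)
  also have "?M a + ln (ratio a) / 2 = ln (force_ratio a) / 2"
  proof -
    have "0 < (2 * a + s + 1) / (2 * a + s - 1)"
      using a0 s_ge_1 by (intro divide_pos_pos) linarith+
    moreover have "a + a = 2 * a" by simp
    ultimately show ?thesis unfolding force_ratio_def
      using ratio_pos[OF a0] by (simp only: ln_mult_pos add_divide_distrib add.commute)
  qed
  finally show ?thesis unfolding racah_force_eq by simp
qed

text \<open>The reflection permutes the 2n points and changes the sign of both sides, so the case of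
  \<open>X n\<close> suffices.\<close>

lemma balance:
  assumes n: "n \<le> N" and a: "a \<in> X n \<union> Y n"
  shows "(\<Sum>r\<in>X n \<union> Y n - {a}. ln ((a - r + 1) / (a - r - 1)) / 2) =
    - racah_force (- real N - 1) \<beta> \<gamma> \<delta> a"
proof (cases "a \<in> X n")
  case True
  then show ?thesis by (rule balance_X[OF n])
next
  case False
  let ?\<rho> = "\<lambda>r. - s - r"
  from False a obtain b where b: "b \<in> X n" "a = ?\<rho> b" by (auto simp: Y_eq_image)
  have "?\<rho> ` (X n \<union> Y n) = X n \<union> Y n"
    by (auto simp: Y_eq_image image_Un image_image)
  moreover have inj: "inj_on ?\<rho> A" for A by (auto simp: inj_on_def)
  ultimately have "X n \<union> Y n - {a} = ?\<rho> ` (X n \<union> Y n - {b})"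
    unfolding b(2) by (simp only: image_set_diff[OF inj] image_insert image_empty)
  then have "(\<Sum>r\<in>X n \<union> Y n - {a}. ln ((a - r + 1) / (a - r - 1)) / 2) =
      (\<Sum>r\<in>X n \<union> Y n - {b}. ln ((a - ?\<rho> r + 1) / (a - ?\<rho> r - 1)) / 2)"
    by (simp only:) (subst sum.reindex[OF inj], simp)
  also have "\<dots> = (\<Sum>r\<in>X n \<union> Y n - {b}. - (ln ((b - r + 1) / (b - r - 1)) / 2))"
  proof (rule sum.cong)
    fix r
    have "(a - ?\<rho> r + 1) / (a - ?\<rho> r - 1) = inverse ((b - r + 1) / (b - r - 1))"
      unfolding inverse_divide b(2) by (subst minus_divide_divide[symmetric]) (simp add: algebra_simps)
    then show "ln ((a - ?\<rho> r + 1) / (a - ?\<rho> r - 1)) / 2 = - (ln ((b - r + 1) / (b - r - 1)) / 2)"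
      by (simp only: ln_inverse)
  qed simp
  finally show ?thesis
    unfolding sum_negf balance_X[OF n b(1)] b(2) racah_force_reflect .
qed

subsection \<open>Equilibrium\<close>

text \<open>Only the two images are prescribed, because minimizers are determined up to relabelling
  within each block.\<close>

definition zero_config :: "nat \<Rightarrow> (nat \<Rightarrow> real) \<Rightarrow> bool" where
  "zero_config n z \<longleftrightarrow> z ` {1..n} = X n \<and> z ` {n+1..2*n} = Y n"

abbreviation admissible_config :: "nat \<Rightarrow> (nat \<Rightarrow> real) \<Rightarrow> bool" where
  "admissible_config n \<equiv> admissible n 0 (real N) (- real N - \<gamma> - \<delta> - 1) (- \<gamma> - \<delta> - 1)"

lemma zero_config_image: "zero_config n z \<Longrightarrow> z ` {1..2*n} = X n \<union> Y n"
  unfolding zero_config_def index_blocks image_Un by simp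

lemma zero_config_inj:
  assumes "n \<le> N" "zero_config n z"
  shows "inj_on z {1..2*n}"
proof (rule eq_card_imp_inj_on)
  show "card (z ` {1..2*n}) = card {1..2*n}"
    unfolding zero_config_image[OF assms(2)]
    using XY_disjoint card_X[OF assms(1)] card_Y[OF assms(1)] finite_X[OF assms(1)] finite_Y[OF assms(1)]
    by (simp add: card_Un_disjoint)
qed simp

lemma zero_config_admissible:
  assumes n: "n \<le> N" and z: "zero_config n z"
  shows "admissible_config n z"
proof -
  have X: "z j \<in> X n" if "j \<in> {1..n}" for j using that z by (auto simp: zero_config_def)
  have Y: "z j \<in> Y n" if "j \<in> {n+1..2*n}" for j using that z unfolding zero_config_def by blast
  have "1 < \<bar>z j - z k\<bar>" if "j \<in> {1..2*n}" "k \<in> {1..2*n}" "j \<noteq> k" for j k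
  proof (rule XY_gap[OF n])
    show "z j \<in> X n \<union> Y n" "z k \<in> X n \<union> Y n"
      using that zero_config_image[OF z] by blast+
    show "z j \<noteq> z k" using that zero_config_inj[OF n z] by (auto dest: inj_onD)
  qed
  moreover have "z j \<in> {0<..<real N}" if "j \<in> {1..n}" for j using X[OF that] by (simp add: X_def)
  moreover have "z j \<in> {- real N - \<gamma> - \<delta> - 1<..<- \<gamma> - \<delta> - 1}" if "j \<in> {n+1..2*n}" for j
    using Y[OF that] by (simp add: Y_def)
  ultimately show ?thesis unfolding admissible_def by blast
qed

lemma zero_config_energy:
  assumes "n \<le> N" "zero_config n x" "zero_config n z"
  shows "energy (2 * n) \<phi> x = energy (2 * n) \<phi> z"
  unfolding energy_reindex[OF zero_config_inj[OF assms(1,2)]] energy_reindex[OF zero_config_inj[OF assms(1,3)]]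
    zero_config_image[OF assms(2)] zero_config_image[OF assms(3)] ..

lemma ex_aligned_zero_config:
  assumes n: "n \<le> N" and y: "admissible_config n y"
  shows "\<exists>x. zero_config n x \<and>
    (\<forall>j\<in>{1..n}. \<forall>k\<in>{1..n}. y j < y k \<longrightarrow> x j < x k) \<and>
    (\<forall>j\<in>{n+1..2*n}. \<forall>k\<in>{n+1..2*n}. y j < y k \<longrightarrow> x j < x k)"
proof -
  have inj: "inj_on y {1..2*n}"
  proof (rule inj_onI)
    fix j k assume jk: "j \<in> {1..2*n}" "k \<in> {1..2*n}" "y j = y k"
    show "j = k"
    proof (rule ccontr)
      assume "j \<noteq> k"
      with jk y have "1 < \<bar>y j - y k\<bar>" unfolding admissible_def by blast
      with jk show False by simp
    qed
  qed
  have "inj_on y {1..n}" "inj_on y {n+1..2*n}" by (rule inj_on_subset[OF inj]; auto)+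
  then obtain u v where u: "bij_betw u {1..n} (X n)"
      "\<forall>j\<in>{1..n}. \<forall>k\<in>{1..n}. y j < y k \<longrightarrow> u j < u k"
    and v: "bij_betw v {n+1..2*n} (Y n)"
      "\<forall>j\<in>{n+1..2*n}. \<forall>k\<in>{n+1..2*n}. y j < y k \<longrightarrow> v j < v k"
    using ex_order_isomorphic_bij[of "{1..n}" y "X n"] ex_order_isomorphic_bij[of "{n+1..2*n}" y "Y n"]
      card_X[OF n] card_Y[OF n] finite_X[OF n] finite_Y[OF n] by auto
  define x where "x j = (if j \<le> n then u j else v j)" for j
  have "x ` {1..n} = u ` {1..n}" "x ` {n+1..2*n} = v ` {n+1..2*n}"
    by (intro image_cong; simp add: x_def)+
  then have "zero_config n x" using u(1) v(1) by (simp add: zero_config_def bij_betw_def)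
  moreover have "\<forall>j\<in>{1..n}. \<forall>k\<in>{1..n}. y j < y k \<longrightarrow> x j < x k"
    using u(2) by (simp add: x_def)
  moreover have "\<forall>j\<in>{n+1..2*n}. \<forall>k\<in>{n+1..2*n}. y j < y k \<longrightarrow> x j < x k"
    using v(2) by (simp add: x_def)
  ultimately show ?thesis by blast
qed

text \<open>The field is strictly convex on each interval. On the mirror interval the reflection
  reverses both the order and the sign of the force, so the force decreases there too.\<close>

lemma field_tangent:
  assumes field: "racah_field N \<beta> \<gamma> \<delta> \<phi>"
    and uv: "u \<in> {0<..<real N} \<and> v \<in> {0<..<real N} \<or>
      u \<in> {- real N - s<..<- s} \<and> v \<in> {- real N - s<..<- s}" and "u \<noteq> v"
  shows "\<phi> u - racah_force (- real N - 1) \<beta> \<gamma> \<delta> u * (v - u) < \<phi> v"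
proof -
  let ?F = "racah_force (- real N - 1) \<beta> \<gamma> \<delta>"
  define S where "S = (if 0 < u then {0<..<real N} else {- real N - s<..<- s})"
  have F_less: "?F y < ?F x" if "0 < x" "x < y" "y < real N" for x y
    using that force_ratio_strict_mono[OF that] force_ratio_pos[of x] by (simp add: racah_force_eq)
  have "\<phi> u + (- ?F u) * (v - u) < \<phi> v"
  proof (rule strict_tangent_below[where S = S])
    show "(\<phi> has_real_derivative - ?F t) (at t)" if "t \<in> S" for t
      using that field by (auto simp: racah_field_def S_def diff_diff_eq split: if_splits)
    show "strict_mono_on S (\<lambda>t. - ?F t)"
    proof (rule strict_mono_onI)
      fix x y assume xy: "x \<in> S" "y \<in> S" "x < y"
      show "- ?F x < - ?F y"
      proof (cases "0 < u")
        case True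
        with xy F_less[of x y] show ?thesis by (auto simp: S_def)
      next
        case False
        with xy F_less[of "- s - y" "- s - x"] show ?thesis
          unfolding racah_force_reflect by (auto simp: S_def)
      qed
    qed
    show "{min u v..max u v} \<subseteq> S"
      using uv s_ge_1 by (auto simp: S_def)
  qed fact
  then show ?thesis by simp
qed

text \<open>Equal order keeps corresponding differences on the same side of the excluded zone, so
  the tangent inequality applies to every pair. What remains are the convexity remainders of the
  field, positive wherever the configurations differ; this also gives the second, rigidity
  claim.\<close>

lemma zero_config_energy_le:
  assumes n: "n \<le> N" and field: "racah_field N \<beta> \<gamma> \<delta> \<phi>"
    and x: "zero_config n x" and y: "admissible_config n y"
    and aligned: "\<And>j k. j \<in> {1..n} \<Longrightarrow> k \<in> {1..n} \<Longrightarrow> y j < y k \<Longrightarrow> x j < x k"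
      "\<And>j k. j \<in> {n+1..2*n} \<Longrightarrow> k \<in> {n+1..2*n} \<Longrightarrow> y j < y k \<Longrightarrow> x j < x k"
  shows "energy (2 * n) \<phi> x \<le> energy (2 * n) \<phi> y"
    and "energy (2 * n) \<phi> y \<le> energy (2 * n) \<phi> x \<Longrightarrow> j \<in> {1..2*n} \<Longrightarrow> y j = x j"
proof -
  let ?F = "racah_force (- real N - 1) \<beta> \<gamma> \<delta>"
  let ?D = "\<lambda>j. \<phi> (y j) - \<phi> (x j) + ?F (x j) * (y j - x j)"
  have s_eq: "- real N - \<gamma> - \<delta> - 1 = - real N - s" "- \<gamma> - \<delta> - 1 = - s" by simp_all
  note x' = zero_config_admissible[OF n x, unfolded admissible_def s_eq]
    and y' = y[unfolded admissible_def s_eq]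
  have gaps: "1 < \<bar>x j - x k\<bar>" "1 < \<bar>y j - y k\<bar>"
    if "j \<in> {1..2*n}" "k \<in> {1..2*n}" "j \<noteq> k" for j k
    using x'[THEN conjunct2, THEN conjunct2] y'[THEN conjunct2, THEN conjunct2] that by metis+
  have first: "x j \<in> {0<..<real N}" "y j \<in> {0<..<real N}" if "j \<in> {1..n}" for j
    using bspec[OF x'[THEN conjunct1] that] bspec[OF y'[THEN conjunct1] that] .
  have second: "x j \<in> {- real N - s<..<- s}" "y j \<in> {- real N - s<..<- s}" if "j \<in> {n+1..2*n}" for j
    using bspec[OF x'[THEN conjunct2, THEN conjunct1] that]
      bspec[OF y'[THEN conjunct2, THEN conjunct1] that] .
  have D_pos: "0 < ?D j" if "j \<in> {1..2*n}" "y j \<noteq> x j" for j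
    using field_tangent[OF field, of "x j" "y j"] first[of j] second[of j] that
    unfolding index_blocks by auto
  then have D_nonneg: "0 \<le> ?D j" if "j \<in> {1..2*n}" for j
    using that by (cases "y j = x j") (auto intro: less_imp_le)
  have tangent: "energy (2 * n) \<phi> x + 2 * sum ?D {1..2*n} \<le> energy (2 * n) \<phi> y"
  proof (rule energy_tangent)
    fix j k assume jk: "j \<in> {1..2*n}" "k \<in> {1..2*n}" "j \<noteq> k"
    consider "j \<in> {1..n}" "k \<in> {1..n}" | "j \<in> {n+1..2*n}" "k \<in> {n+1..2*n}"
      | "j \<in> {1..n}" "k \<in> {n+1..2*n}" | "j \<in> {n+1..2*n}" "k \<in> {1..n}"
      using jk unfolding index_blocks by blast
    then show "(1 < x j - x k \<and> 1 < y j - y k) \<or> (x j - x k < -1 \<and> y j - y k < -1)"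
    proof cases
      case 1
      then show ?thesis using gaps[OF jk] aligned(1)[of j k] aligned(1)[of k j] by argo
    next
      case 2
      then show ?thesis using gaps[OF jk] aligned(2)[of j k] aligned(2)[of k j] by argo
    next
      case 3
      with first[of j] second[of k] s_ge_1 show ?thesis by auto
    next
      case 4
      with first[of k] second[of j] s_ge_1 show ?thesis by auto
    qed
  next
    fix j assume j: "j \<in> {1..2*n}"
    have inj: "inj_on x {1..2*n}" by (rule zero_config_inj[OF n x])
    have img: "x ` ({1..2*n} - {j}) = X n \<union> Y n - {x j}"
      unfolding zero_config_image[OF x, symmetric]
      using inj_on_image_set_diff[OF inj, of "{1..2*n}" "{j}"] j by simp
    have "x j \<in> X n \<union> Y n" using j zero_config_image[OF x] by blast
    from balance[OF n this]
    show "(\<Sum>k\<in>{1..2*n} - {j}. ln ((x j - x k + 1) / (x j - x k - 1)) / 2) = - ?F (x j)"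
      unfolding img[symmetric] by (subst (asm) sum.reindex) (rule inj_on_diff[OF inj], simp)
  qed
  with sum_nonneg[of "{1..2*n}" ?D] D_nonneg show "energy (2 * n) \<phi> x \<le> energy (2 * n) \<phi> y"
    by fastforce
  assume le: "energy (2 * n) \<phi> y \<le> energy (2 * n) \<phi> x" and j: "j \<in> {1..2*n}"
  show "y j = x j"
  proof (rule ccontr)
    assume "y j \<noteq> x j"
    then have "0 < sum ?D {1..2*n}"
      using D_nonneg D_pos[OF j] j by (intro sum_pos2[of _ j]) auto
    with tangent le show False by linarith
  qed
qed

text \<open>For one direction, relabelling the roots to match a competitor leaves their energy
  unchanged. For the other, a minimizer is compared with the roots labelled in its own order, and
  rigidity makes the two coincide.\<close>

lemma equilibrium_iff:
  assumes n: "n \<le> N" and field: "racah_field N \<beta> \<gamma> \<delta> \<phi>"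
  shows "equilibrium n 0 (real N) (- real N - \<gamma> - \<delta> - 1) (- \<gamma> - \<delta> - 1) \<phi> z \<longleftrightarrow> zero_config n z"
proof
  assume z: "zero_config n z"
  have "energy (2 * n) \<phi> z \<le> energy (2 * n) \<phi> y" if y: "admissible_config n y" for y
  proof -
    from ex_aligned_zero_config[OF n y] obtain x where "zero_config n x"
      "energy (2 * n) \<phi> x \<le> energy (2 * n) \<phi> y"
      using zero_config_energy_le(1)[OF n field _ y] by blast
    then show ?thesis using zero_config_energy[OF n z] by simp
  qed
  then show "equilibrium n 0 (real N) (- real N - \<gamma> - \<delta> - 1) (- \<gamma> - \<delta> - 1) \<phi> z"
    unfolding equilibrium_def using zero_config_admissible[OF n z] by blast
next
  assume eq: "equilibrium n 0 (real N) (- real N - \<gamma> - \<delta> - 1) (- \<gamma> - \<delta> - 1) \<phi> z"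
  then have z: "admissible_config n z" by (simp add: equilibrium_def)
  from ex_aligned_zero_config[OF n z] obtain x where x: "zero_config n x"
    "\<And>j k. j \<in> {1..n} \<Longrightarrow> k \<in> {1..n} \<Longrightarrow> z j < z k \<Longrightarrow> x j < x k"
    "\<And>j k. j \<in> {n+1..2*n} \<Longrightarrow> k \<in> {n+1..2*n} \<Longrightarrow> z j < z k \<Longrightarrow> x j < x k" by blast
  have "energy (2 * n) \<phi> z \<le> energy (2 * n) \<phi> x"
    using eq zero_config_admissible[OF n x(1)] by (simp add: equilibrium_def)
  from zero_config_energy_le(2)[OF n field x(1) z x(2,3) this]
  have "z j = x j" if "j \<in> {1..2*n}" for j using that by blast
  then have "z ` {1..n} = x ` {1..n}" "z ` {n+1..2*n} = x ` {n+1..2*n}"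
    by (intro image_cong; simp)+
  with x(1) show "zero_config n z" by (simp add: zero_config_def)
qed

text \<open>The 2n distinct roots already exhaust the degree, so \<open>P n\<close> is a constant
  times a product of distinct linear factors.\<close>

lemma P_simple_root:
  assumes n: "n \<le> N" and a: "a \<in> X n \<union> Y n"
  shows "order a (P n) = 1"
proof -
  have deg: "degree (P n) = 2 * n"
    using degree_R(1)[OF n] by (simp add: P_def racah_of_lambda_def degree_pcompose racah_lambda_def R_def)
  have nz: "P n \<noteq> 0"
  proof
    assume 0: "P n = 0"
    then have "n = 0" using deg by simp
    with 0 coefficient_diag_nonzero[OF n] poly_P_sum[of n 0] show False by (simp add: basis_def)
  qed
  let ?Z = "{z. poly (P n) z = 0}"
  have fin: "finite ?Z" by (rule poly_roots_finite[OF nz])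
  have "X n \<union> Y n \<subseteq> ?Z" by (auto simp: X_def Y_def)
  from card_mono[OF fin this] have "degree (P n) \<le> card ?Z"
    using XY_disjoint card_X[OF n] card_Y[OF n] finite_X[OF n] finite_Y[OF n] deg
    by (simp add: card_Un_disjoint)
  moreover have "card ?Z \<le> degree (P n)" using nz card_poly_roots_bound by blast
  ultimately have "P n = smult (lead_coeff (P n)) (\<Prod>z\<in>?Z. [:- z, 1:])"
    by (intro poly_eq_prod_of_card_roots nz) simp
  also have aZ: "a \<in> ?Z" using a by (auto simp: X_def Y_def)
  have "(\<Prod>z\<in>?Z. [:- z, 1:]) = [:- a, 1:] * (\<Prod>z\<in>?Z - {a}. [:- z, 1:])"
    by (rule prod.remove[OF fin aZ])
  finally have P: "P n = [:- a, 1:] * smult (lead_coeff (P n)) (\<Prod>z\<in>?Z - {a}. [:- z, 1:])"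
    by (simp only: mult_smult_right)
  have "poly (smult (lead_coeff (P n)) (\<Prod>z\<in>?Z - {a}. [:- z, 1:])) a \<noteq> 0"
    using nz fin by (simp add: poly_prod)
  then have not_dvd: "\<not> [:- a, 1:] dvd smult (lead_coeff (P n)) (\<Prod>z\<in>?Z - {a}. [:- z, 1:])"
    unfolding poly_eq_0_iff_dvd .
  have "\<not> [:- a, 1:] ^ Suc 1 dvd P n"
  proof
    assume "[:- a, 1:] ^ Suc 1 dvd P n"
    then have "[:- a, 1:] * [:- a, 1:] dvd
        [:- a, 1:] * smult (lead_coeff (P n)) (\<Prod>z\<in>?Z - {a}. [:- z, 1:])"
      using P by (simp only: power_Suc power_0 One_nat_def mult_1_right)
    with not_dvd show False by (subst (asm) dvd_mult_cancel_left) auto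
  qed
  moreover have "[:- a, 1:] ^ 1 dvd P n" using aZ by (simp add: poly_eq_0_iff_dvd)
  ultimately show ?thesis by (metis order_unique_lemma)
qed

subsection \<open>Monotonicity in the parameters\<close>

lemma racah_points_eq: "racah_points n N \<beta> \<gamma> \<delta> = sorted_list_of_set (X n)"
  by (simp add: racah_points_def X_def P_def)

lemma racah_zeros_eq:
  assumes "n \<le> N"
  shows "racah_zeros n N \<beta> \<gamma> \<delta> = map lam (racah_points n N \<beta> \<gamma> \<delta>)"
proof (rule strict_sorted_equal)
  have fin: "finite (X n)" by (rule finite_X[OF assms])
  have zeros: "racah_zeros n N \<beta> \<gamma> \<delta> = sorted_list_of_set (lam ` X n)"
    unfolding lam_image_X[OF assms] by (simp add: racah_zeros_def R_def)
  show "sorted_wrt (<) (racah_zeros n N \<beta> \<gamma> \<delta>)"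
    unfolding zeros by (rule strict_sorted_list_of_set)
  show "sorted_wrt (<) (map lam (racah_points n N \<beta> \<gamma> \<delta>))"
    unfolding sorted_wrt_map racah_points_eq
    by (rule sorted_wrt_mono_rel[OF _ strict_sorted_list_of_set])
      (use fin X_bounds in \<open>simp add: lam_less_iff less_imp_le\<close>)
  show "set (racah_zeros n N \<beta> \<gamma> \<delta>) = set (map lam (racah_points n N \<beta> \<gamma> \<delta>))"
    unfolding zeros racah_points_eq using fin by simp
qed

lemma length_points: "n \<le> N \<Longrightarrow> length (racah_points n N \<beta> \<gamma> \<delta>) = n"
  by (simp add: racah_points_eq card_X)

lemma point_in_X: "n \<le> N \<Longrightarrow> j < n \<Longrightarrow> racah_points n N \<beta> \<gamma> \<delta> ! j \<in> X n"
  unfolding racah_points_eq by (metis card_X finite_X length_sorted_list_of_set nth_mem set_sorted_list_of_set)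

lemma points_gap:
  assumes "n \<le> N" "j < k" "k < n"
  shows "1 < racah_points n N \<beta> \<gamma> \<delta> ! k - racah_points n N \<beta> \<gamma> \<delta> ! j"
proof (rule root_gap[OF assms(1)])
  show "racah_points n N \<beta> \<gamma> \<delta> ! j < racah_points n N \<beta> \<gamma> \<delta> ! k"
    unfolding racah_points_eq using assms by (intro sorted_list_of_set_nth_less) (simp_all add: card_X)
qed (use assms point_in_X in auto)

lemma points_critical:
  assumes n: "n \<le> N" and j: "j < n"
  shows "(\<Prod>k\<in>{..<n} - {j}. gap_factor s (racah_points n N \<beta> \<gamma> \<delta> ! j) (racah_points n N \<beta> \<gamma> \<delta> ! k)) =
    ratio (racah_points n N \<beta> \<gamma> \<delta> ! j)"
proof -
  let ?x = "\<lambda>k. racah_points n N \<beta> \<gamma> \<delta> ! k"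
  have bij: "bij_betw ?x {..<n} (X n)"
    unfolding racah_points_eq
    by (rule bij_betw_nth) (simp_all add: card_X[OF n] finite_X[OF n])
  then have "X n - {?x j} = ?x ` ({..<n} - {j})"
    using j by (auto simp: bij_betw_def dest: inj_onD)
  moreover have "inj_on ?x ({..<n} - {j})"
    using bij by (auto simp: bij_betw_def intro: inj_on_diff)
  ultimately show ?thesis
    using critical_ratio[OF n point_in_X[OF n j]] by (simp add: prod.reindex)
qed

end

text \<open>The ratios are compared on the primed interval because the maximum principle asks for it
  only at points not above a root of the primed problem.\<close>

lemma points_less:
  assumes p: "racah_params N \<beta> \<gamma> \<delta>" and q: "racah_params N' \<beta>' \<gamma> \<delta>" and n: "n \<le> N" "n \<le> N'"
    and less: "\<And>x. 0 < x \<Longrightarrow> x < real N' \<Longrightarrow>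
      racah_params.ratio N \<beta> \<gamma> \<delta> x < racah_params.ratio N' \<beta>' \<gamma> \<delta> x"
    and k: "k < n"
  shows "racah_points n N' \<beta>' \<gamma> \<delta> ! k < racah_points n N \<beta> \<gamma> \<delta> ! k"
proof -
  interpret p: racah_params N \<beta> \<gamma> \<delta> by (rule p)
  interpret q: racah_params N' \<beta>' \<gamma> \<delta> by (rule q)
  have x: "0 < racah_points n N \<beta> \<gamma> \<delta> ! j" if "j < n" for j
    using p.X_bounds[OF p.point_in_X[OF n(1) that]] by simp
  have z: "0 < racah_points n N' \<beta>' \<gamma> \<delta> ! j" "racah_points n N' \<beta>' \<gamma> \<delta> ! j < real N'" if "j < n" for j
    using q.X_bounds[OF q.point_in_X[OF n(2) that]] by simp_all
  show ?thesis
  proof (rule critical_comparison[OF p.s_ge_1, where g = p.ratio and h = q.ratio])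
    fix j assume j: "j < n" and le: "racah_points n N \<beta> \<gamma> \<delta> ! j \<le> racah_points n N' \<beta>' \<gamma> \<delta> ! j"
    have "p.ratio (racah_points n N \<beta> \<gamma> \<delta> ! j) < q.ratio (racah_points n N \<beta> \<gamma> \<delta> ! j)"
      using less x[OF j] le z(2)[OF j] by simp
    also have "\<dots> \<le> q.ratio (racah_points n N' \<beta>' \<gamma> \<delta> ! j)"
      using q.ratio_strict_mono[OF x[OF j] _ z(2)[OF j]] le
      by (cases "racah_points n N \<beta> \<gamma> \<delta> ! j = racah_points n N' \<beta>' \<gamma> \<delta> ! j") (auto simp: less_imp_le)
    finally show "p.ratio (racah_points n N \<beta> \<gamma> \<delta> ! j) < q.ratio (racah_points n N' \<beta>' \<gamma> \<delta> ! j)" .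
  qed (use x z k n p.points_gap q.points_gap p.points_critical q.points_critical in auto)
qed

lemma zeros_less:
  assumes p: "racah_params N \<beta> \<gamma> \<delta>" and q: "racah_params N' \<beta>' \<gamma> \<delta>" and n: "n \<le> N" "n \<le> N'"
    and k: "k < n" and less: "racah_points n N' \<beta>' \<gamma> \<delta> ! k < racah_points n N \<beta> \<gamma> \<delta> ! k"
  shows "racah_zeros n N' \<beta>' \<gamma> \<delta> ! k < racah_zeros n N \<beta> \<gamma> \<delta> ! k"
proof -
  interpret p: racah_params N \<beta> \<gamma> \<delta> by (rule p)
  interpret q: racah_params N' \<beta>' \<gamma> \<delta> by (rule q)
  have "p.lam = q.lam" by (simp add: fun_eq_iff p.lam_def q.lam_def)
  moreover have "p.lam (racah_points n N' \<beta>' \<gamma> \<delta> ! k) < p.lam (racah_points n N \<beta> \<gamma> \<delta> ! k)"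
    using less p.X_bounds[OF p.point_in_X[OF n(1) k]] q.X_bounds[OF q.point_in_X[OF n(2) k]]
    by (subst p.lam_less_iff) auto
  ultimately show ?thesis
    using n k by (simp add: p.racah_zeros_eq q.racah_zeros_eq p.length_points q.length_points)
qed

text \<open>N enters \<open>ratio\<close> only through (x + N + s) / (N - x) = 1 + (2x + s) / (N -
  x), which decreases in N. Hence the larger parameter takes the unprimed role in
  \<open>points_less\<close>.\<close>

lemma points_less_N:
  assumes p: "racah_params M \<beta> \<gamma> \<delta>" and q: "racah_params M' \<beta> \<gamma> \<delta>" and "n \<le> M" "M < M'" "k < n"
  shows "racah_points n M \<beta> \<gamma> \<delta> ! k < racah_points n M' \<beta> \<gamma> \<delta> ! k"
proof (rule points_less[OF q p])
  interpret p: racah_params M \<beta> \<gamma> \<delta> by (rule p)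
  interpret q: racah_params M' \<beta> \<gamma> \<delta> by (rule q)
  fix x :: real assume x: "0 < x" "x < real M"
  define A where "A = x / (x + \<gamma> + 1) * ((x + \<delta>) / (x + p.s)) * ((\<beta> - \<gamma> - x) / (x + \<beta> + \<delta> + 1))"
  have split: "p.ratio x = A * ((x + real M + p.s) / (real M - x))"
    "q.ratio x = A * ((x + real M' + p.s) / (real M' - x))"
    unfolding p.ratio_def q.ratio_def A_def times_divide_times_eq by (simp_all only: ac_simps)
  have "0 < A" unfolding A_def using x p.gamma_nonneg p.delta_nonneg p.beta_gt
    by (intro mult_pos_pos divide_pos_pos) linarith+
  moreover have "0 < (real M' - real M) * (2 * x + p.s)"
    using assms x p.s_ge_1 by (intro mult_pos_pos) auto
  then have "(x + real M' + p.s) / (real M' - x) < (x + real M + p.s) / (real M - x)"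
    using assms x by (intro divide_less_cross) (auto simp: algebra_simps)
  ultimately show "q.ratio x < p.ratio x" unfolding split by (intro mult_strict_left_mono)
qed (use assms in auto)

text \<open>\<beta> enters \<open>ratio\<close> only through (\<beta> - \<gamma> - x) / (x + \<beta>
  + \<delta> + 1) = 1 - (2x + s) / (x + \<beta> + \<delta> + 1), which increases in \<beta>.\<close>

lemma points_less_beta:
  assumes p: "racah_params N b \<gamma> \<delta>" and q: "racah_params N b' \<gamma> \<delta>" and "n \<le> N" "b < b'" "k < n"
  shows "racah_points n N b' \<gamma> \<delta> ! k < racah_points n N b \<gamma> \<delta> ! k"
proof (rule points_less[OF p q])
  interpret p: racah_params N b \<gamma> \<delta> by (rule p)
  interpret q: racah_params N b' \<gamma> \<delta> by (rule q)
  fix x :: real assume x: "0 < x" "x < real N"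
  define A where "A = x / (x + \<gamma> + 1) * ((x + \<delta>) / (x + p.s)) * ((x + real N + p.s) / (real N - x))"
  have split: "p.ratio x = A * ((b - \<gamma> - x) / (x + b + \<delta> + 1))"
    "q.ratio x = A * ((b' - \<gamma> - x) / (x + b' + \<delta> + 1))"
    unfolding p.ratio_def q.ratio_def A_def times_divide_times_eq by (simp_all only: ac_simps)
  have "0 < A" unfolding A_def using x p.gamma_nonneg p.delta_nonneg p.beta_gt
    by (intro mult_pos_pos divide_pos_pos) linarith+
  moreover have "0 < (b' - b) * (2 * x + p.s)"
    using assms x p.s_ge_1 by (intro mult_pos_pos) auto
  then have "(b - \<gamma> - x) / (x + b + \<delta> + 1) < (b' - \<gamma> - x) / (x + b' + \<delta> + 1)"
    using x p.gamma_nonneg p.delta_nonneg p.beta_gt q.beta_gt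
    by (intro divide_less_cross) (auto simp: algebra_simps)
  ultimately show "p.ratio x < q.ratio x" unfolding split by (intro mult_strict_left_mono)
qed (use assms in auto)

theorem mainTheorem14:
  fixes n N :: nat and \<beta> \<gamma> \<delta> :: real
  assumes "0 \<le> \<gamma>" and "0 \<le> \<delta>" and "\<beta> > \<gamma> + real N" and "1 \<le> n" and "n \<le> N"
  shows
    "(let \<alpha> = - real N - 1;
          P = racah_of_lambda n \<alpha> \<beta> \<gamma> \<delta>;
          X = {x \<in> {0<..<real N}. poly P x = 0};
          Y = {x \<in> {- real N - \<gamma> - \<delta> - 1<..<- \<gamma> - \<delta> - 1}. poly P x = 0}
      in card X = n \<and> card Y = n \<and>
         (\<forall>x\<in>X \<union> Y. order x P = 1) \<and>
         (\<forall>x\<in>X \<union> Y. \<forall>y\<in>X \<union> Y. x \<noteq> y \<longrightarrow> 1 < \<bar>x - y\<bar>) \<and>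
         (\<forall>\<phi>. racah_field N \<beta> \<gamma> \<delta> \<phi> \<longrightarrow>
            (\<forall>z. equilibrium n 0 (real N) (- real N - \<gamma> - \<delta> - 1) (- \<gamma> - \<delta> - 1) \<phi> z \<longleftrightarrow>
                 z ` {1..n} = X \<and> z ` {n+1..2*n} = Y))) \<and>
     racah_zeros n N \<beta> \<gamma> \<delta> =
       map (poly (racah_lambda \<gamma> \<delta>)) (racah_points n N \<beta> \<gamma> \<delta>) \<and>
     (\<forall>k<n.
        strict_mono_on {M. n \<le> M \<and> \<gamma> + real M < \<beta>} (\<lambda>M. racah_points n M \<beta> \<gamma> \<delta> ! k) \<and>
        strict_mono_on {M. n \<le> M \<and> \<gamma> + real M < \<beta>} (\<lambda>M. racah_zeros n M \<beta> \<gamma> \<delta> ! k) \<and>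
        strict_antimono_on {\<gamma> + real N<..} (\<lambda>b. racah_points n N b \<gamma> \<delta> ! k) \<and>
        strict_antimono_on {\<gamma> + real N<..} (\<lambda>b. racah_zeros n N b \<gamma> \<delta> ! k))"
proof -
  interpret racah_params N \<beta> \<gamma> \<delta> using assms by unfold_locales
  note n = \<open>n \<le> N\<close>
  have params: "racah_params M b \<gamma> \<delta>" if "\<gamma> + real M < b" for M b
    using assms that by unfold_locales
  have roots: "card (X n) = n \<and> card (Y n) = n \<and> (\<forall>x\<in>X n \<union> Y n. order x (P n) = 1) \<and>
      (\<forall>x\<in>X n \<union> Y n. \<forall>y\<in>X n \<union> Y n. x \<noteq> y \<longrightarrow> 1 < \<bar>x - y\<bar>) \<and>
      (\<forall>\<phi>. racah_field N \<beta> \<gamma> \<delta> \<phi> \<longrightarrow>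
            (\<forall>z. equilibrium n 0 (real N) (- real N - \<gamma> - \<delta> - 1) (- \<gamma> - \<delta> - 1) \<phi> z \<longleftrightarrow>
                 z ` {1..n} = X n \<and> z ` {n+1..2*n} = Y n))"
    using card_X[OF n] card_Y[OF n] P_simple_root[OF n] XY_gap[OF n]
      equilibrium_iff[OF n, unfolded zero_config_def] by blast
  have zeros: "racah_zeros n N \<beta> \<gamma> \<delta> =
      map (poly (racah_lambda \<gamma> \<delta>)) (racah_points n N \<beta> \<gamma> \<delta>)"
  proof -
    have "poly (racah_lambda \<gamma> \<delta>) = lam"
      by (simp add: fun_eq_iff poly_racah_lambda lam_def algebra_simps)
    then show ?thesis using racah_zeros_eq[OF n] by simp
  qed
  have "racah_points n M \<beta> \<gamma> \<delta> ! k < racah_points n M' \<beta> \<gamma> \<delta> ! k \<and>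
      racah_zeros n M \<beta> \<gamma> \<delta> ! k < racah_zeros n M' \<beta> \<gamma> \<delta> ! k"
    if "k < n" "n \<le> M" "\<gamma> + real M < \<beta>" "\<gamma> + real M' < \<beta>" "M < M'" for k M M'
    using that points_less_N[OF params params, of M \<beta> M' n k]
      zeros_less[OF params params, of M' \<beta> M \<beta> n k] by auto
  moreover have "racah_points n N b' \<gamma> \<delta> ! k < racah_points n N b \<gamma> \<delta> ! k \<and>
      racah_zeros n N b' \<gamma> \<delta> ! k < racah_zeros n N b \<gamma> \<delta> ! k"
    if "k < n" "\<gamma> + real N < b" "b < b'" for k b b'
    using that n points_less_beta[OF params params, of N b b' n k]
      zeros_less[OF params params, of N b N b' n k] by auto
  ultimately have mono: "\<forall>k<n.
        strict_mono_on {M. n \<le> M \<and> \<gamma> + real M < \<beta>} (\<lambda>M. racah_points n M \<beta> \<gamma> \<delta> ! k) \<and>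
        strict_mono_on {M. n \<le> M \<and> \<gamma> + real M < \<beta>} (\<lambda>M. racah_zeros n M \<beta> \<gamma> \<delta> ! k) \<and>
        strict_antimono_on {\<gamma> + real N<..} (\<lambda>b. racah_points n N b \<gamma> \<delta> ! k) \<and>
        strict_antimono_on {\<gamma> + real N<..} (\<lambda>b. racah_zeros n N b \<gamma> \<delta> ! k)"
    by (auto simp: monotone_on_def)
  show ?thesis
    unfolding Let_def using roots zeros mono unfolding X_def Y_def P_def by blast
qed

end
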